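(* Let $K$ be a finite field, $F$ a free group of finite rank, and $Q$ a matrix over $K[F]$. Let $L$ and $M$ be algebraic extensions of the column space $R_Q$ of $Q$ such that $L\le M$. Then $\phi_{L,M}=\phi_{M^{*Q},L^{*Q}}$ (equality as functions of $N\in\mathbb{Z}_{\ge1}$).
   Context: $\mathcal{A}=K[F]$ is the free group algebra. It is a free ideal ring: every submodule of a free (left or right) $\mathcal{A}$-module is free, of well-defined rank, denoted $\mathrm{rk}$. For a free $\mathcal{A}$-module $N$ and a submodule $M\le N$: $M$ is a free factor of $N$, written $M\le_* N$, if a basis of $M$ can be extended to a basis of $N$; the extension is algebraic, written $M\le_{\mathrm{alg}}N$, if there is no free factor $L$ of $N$ with $M\le L\subsetneq N$. Let $Q$ be $k\times m$. $\mathcal{A}^k$ is the right $\mathcal{A}$-module of column vectors and $\mathcal{A}^m$ the left $\mathcal{A}$-module of row vectors. For any matrix $X$ over $\mathcal{A}$, $R_X$ is the right submodule generated by its columns and $L_X$ the left submodule generated by its rows. Algebraic extensions of $R_Q$ are right submodules $M\le\mathcal{A}^k$ with $R_Q\le_{\mathrm{alg}}M$. $Q$-dual: Let $R_Q\le M\le\mathcal{A}^k$. Choose a finitely generated free factor $M_{\mathrm{fin}}\le_* M$ containing $R_Q$ (one exists) and a basis $f_1,\dots,f_t$ of it; let $B\in\mathrm{Mat}_{t\times m}(\mathcal{A})$ be the unique matrix with $Q=(f_1\,|\,\cdots\,|\,f_t)B$. Then $M^{*Q}:=L_B\le\mathcal{A}^m$, a left submodule which does not depend on the choices and contains $L_Q$.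 Taking $Q$-duals reverses inclusions. Let $q=|K|$. For an extension $L\le M$ of free $K[F]$-modules (both left or both right) with $\mathrm{rk}\,M<\infty$ and $N\in\mathbb{Z}_{\ge1}$, define $$\phi_{L,M}(N):=q^N\cdot\mathbb{P}\left(L\subseteq\ker\varphi_M\right),$$ where the probability is over a uniformly random $K[F]$-module structure on $K^N$ (of the same side as $M$, extending the $K$-vector space structure) and then a uniformly random $K[F]$-module homomorphism $\varphi_M:M\to K^N$. Concretely, fixing a basis $b_1,\dots,b_r$ of $F$, a module structure amounts to a choice of an $r$-tuple in $GL_N(K)^r$, the matrix chosen for $b_i$ giving the action of $b_i$ by right multiplication on row vectors (right modules) or by left multiplication on column vectors (left modules). A homomorphism $\varphi_M$ amounts to a choice of images in $K^N$ of a fixed basis of $M$. Algebraic extensions of $R_Q$ and their $Q$-duals all have finite rank, so both sides of the claimed equality are defined. *)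

theory Defs
  imports
    "HOL-Probability.Probability_Mass_Function"
    "HOL-Library.Poly_Mapping"
    "Jordan_Normal_Form.Matrix"
begin

section \<open>Free groups and their group algebras\<close>

text \<open>
  Groups are types of class \<^class>\<open>group_add\<close>, whose addition is not assumed to be commutative.
  With this convention the group algebra $K[F]$ is the type \<open>'f \<Rightarrow>\<^sub>0 'k\<close> of finitely supported
  functions, because the product of \<^theory>\<open>HOL-Library.Poly_Mapping\<close> is convolution.

  A letter \<open>(s, True)\<close> stands for the generator \<open>s\<close>, and \<open>(s, False)\<close> for its inverse.  A set \<open>S\<close>
  is a free basis if every group element is the value of exactly one reduced word over \<open>S\<close>.
  The set \<open>S\<close> may be empty, so that the trivial group is free of rank zero.
\<close>

definition word_value :: "('f::group_add \<times> bool) list \<Rightarrow> 'f" where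
  "word_value w = sum_list (map (\<lambda>(s, positive). if positive then s else - s) w)"

definition reduced_words :: "'f set \<Rightarrow> ('f \<times> bool) list set" where
  "reduced_words S =
     {w. set w \<subseteq> S \<times> UNIV \<and> successively (\<lambda>x y. \<not> (fst x = fst y \<and> snd x \<noteq> snd y)) w}"

definition free_group_basis :: "'f::group_add set \<Rightarrow> bool" where
  "free_group_basis S \<longleftrightarrow> bij_betw word_value (reduced_words S) UNIV"


section \<open>Left and right submodules of $A^n$\<close>

datatype side = LeftSide | RightSide

text \<open>
  Elements of $A^n$ are of type \<open>'a Matrix.vec\<close> for both sides: they are read as row vectors for
  the left module structure and as column vectors for the right one.
\<close>

fun side_scale :: "side \<Rightarrow> 'a::semigroup_mult \<Rightarrow> 'a Matrix.vec \<Rightarrow> 'a Matrix.vec" where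
  "side_scale LeftSide a v = map_vec (\<lambda>x. a * x) v"
| "side_scale RightSide a v = map_vec (\<lambda>x. x * a) v"

definition submodule :: "side \<Rightarrow> nat \<Rightarrow> 'a::ring_1 Matrix.vec set \<Rightarrow> bool" where
  "submodule s n M \<longleftrightarrow>
     M \<subseteq> carrier_vec n \<and> 0\<^sub>v n \<in> M \<and> (\<forall>x\<in>M. \<forall>y\<in>M. x + y \<in> M)
     \<and> (\<forall>a. \<forall>x\<in>M. side_scale s a x \<in> M)"

definition lin_comb ::
    "side \<Rightarrow> nat \<Rightarrow> ('a::ring_1 Matrix.vec \<Rightarrow> 'a) \<Rightarrow> 'a Matrix.vec set \<Rightarrow> 'a Matrix.vec" where
  "lin_comb s n c X = finsum_vec TYPE('a) n (\<lambda>v. side_scale s (c v) v) X"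

definition module_span :: "side \<Rightarrow> nat \<Rightarrow> 'a::ring_1 Matrix.vec set \<Rightarrow> 'a Matrix.vec set" where
  "module_span s n B = {lin_comb s n c X |c X. finite X \<and> X \<subseteq> B}"

definition module_independent :: "side \<Rightarrow> nat \<Rightarrow> 'a::ring_1 Matrix.vec set \<Rightarrow> bool" where
  "module_independent s n B \<longleftrightarrow>
     (\<forall>X c. finite X \<and> X \<subseteq> B \<and> lin_comb s n c X = 0\<^sub>v n \<longrightarrow> (\<forall>v\<in>X. c v = 0))"

definition module_basis ::
    "side \<Rightarrow> nat \<Rightarrow> 'a::ring_1 Matrix.vec set \<Rightarrow> 'a Matrix.vec set \<Rightarrow> bool" where
  "module_basis s n M B \<longleftrightarrow>
     B \<subseteq> carrier_vec n \<and> module_independent s n B \<and> module_span s n B = M"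

definition free_submodule :: "side \<Rightarrow> nat \<Rightarrow> 'a::ring_1 Matrix.vec set \<Rightarrow> bool" where
  "free_submodule s n M \<longleftrightarrow> submodule s n M \<and> (\<exists>B. module_basis s n M B)"

definition free_factor ::
    "side \<Rightarrow> nat \<Rightarrow> 'a::ring_1 Matrix.vec set \<Rightarrow> 'a Matrix.vec set \<Rightarrow> bool" where
  "free_factor s n M N \<longleftrightarrow>
     (\<exists>B C. module_basis s n M B \<and> module_basis s n N C \<and> B \<subseteq> C)"

definition alg_extension ::
    "side \<Rightarrow> nat \<Rightarrow> 'a::ring_1 Matrix.vec set \<Rightarrow> 'a Matrix.vec set \<Rightarrow> bool" where
  "alg_extension s n M N \<longleftrightarrow>
     free_submodule s n N \<and> submodule s n M \<and> M \<subseteq> N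
     \<and> \<not> (\<exists>L. free_factor s n L N \<and> M \<subseteq> L \<and> L \<subset> N)"


section \<open>Column and row modules, and the dual with respect to a matrix\<close>

definition column_module :: "'a::ring_1 mat \<Rightarrow> 'a Matrix.vec set" where
  "column_module X = module_span RightSide (dim_row X) (set (cols X))"

definition row_module :: "'a::ring_1 mat \<Rightarrow> 'a Matrix.vec set" where
  "row_module X = module_span LeftSide (dim_col X) (set (rows X))"

definition is_Q_dual ::
    "'a::ring_1 mat \<Rightarrow> 'a Matrix.vec set \<Rightarrow> 'a Matrix.vec set \<Rightarrow> bool" where
  "is_Q_dual Q M D \<longleftrightarrow>
     (\<exists>Mfin fs B. free_factor RightSide (dim_row Q) Mfin M \<and> column_module Q \<subseteq> Mfin
        \<and> distinct fs \<and> module_basis RightSide (dim_row Q) Mfin (set fs)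
        \<and> B \<in> carrier_mat (length fs) (dim_col Q)
        \<and> Q = mat_of_cols (dim_row Q) fs * B
        \<and> D = row_module B)"

text \<open>A definite description is used because the dual does not depend on the choices.\<close>

definition Q_dual :: "'a::ring_1 mat \<Rightarrow> 'a Matrix.vec set \<Rightarrow> 'a Matrix.vec set" where
  "Q_dual Q M = (THE D. is_Q_dual Q M D)"


section \<open>Random module structures and the function $\phi$\<close>

text \<open>
  A structure is given by its action map: \<open>act a v\<close> is $a v$ on the left side and $v a$ on the
  right side.  The scalar \<open>c\<close> of $K$ is \<open>Poly_Mapping.single 0 c\<close> in $K[F]$, since \<open>0\<close> is the
  neutral element of the group.
  For a free group with basis $b_1,\dots,b_r$ the structures on $K^N$ correspond to the tuples in
  $GL_N(K)^r$ giving the actions of the $b_i$.  Action maps and homomorphisms are extensional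
  functions, so that they form finite sets (if $F$ has finite rank and \<open>M\<close> is finitely generated).
\<close>

definition module_structures ::
    "side \<Rightarrow> nat \<Rightarrow> (('f::group_add \<Rightarrow>\<^sub>0 'k::field) \<Rightarrow> 'k Matrix.vec \<Rightarrow> 'k Matrix.vec) set" where
  "module_structures s N =
     {act. (\<forall>a. act a \<in> carrier_vec N \<rightarrow>\<^sub>E carrier_vec N)
         \<and> (\<forall>a. \<forall>v\<in>carrier_vec N. \<forall>w\<in>carrier_vec N. act a (v + w) = act a v + act a w)
         \<and> (\<forall>a b. \<forall>v\<in>carrier_vec N. act (a + b) v = act a v + act b v)
         \<and> (\<forall>a b. \<forall>v\<in>carrier_vec N. act (a * b) v =
              (case s of LeftSide \<Rightarrow> act a (act b v) | RightSide \<Rightarrow> act b (act a v)))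
         \<and> (\<forall>v\<in>carrier_vec N. act 1 v = v)
         \<and> (\<forall>c. \<forall>v\<in>carrier_vec N. act (Poly_Mapping.single 0 c) v = c \<cdot>\<^sub>v v)}"

definition module_homs ::
    "side \<Rightarrow> nat \<Rightarrow> (('f::group_add \<Rightarrow>\<^sub>0 'k::field) \<Rightarrow> 'k Matrix.vec \<Rightarrow> 'k Matrix.vec)
      \<Rightarrow> ('f \<Rightarrow>\<^sub>0 'k) Matrix.vec set \<Rightarrow> (('f \<Rightarrow>\<^sub>0 'k) Matrix.vec \<Rightarrow> 'k Matrix.vec) set" where
  "module_homs s N act M =
     {\<phi>. \<phi> \<in> M \<rightarrow>\<^sub>E carrier_vec N
       \<and> (\<forall>x\<in>M. \<forall>y\<in>M. \<phi> (x + y) = \<phi> x + \<phi> y)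
       \<and> (\<forall>a. \<forall>x\<in>M. \<phi> (side_scale s a x) = act a (\<phi> x))}"

definition random_hom ::
    "side \<Rightarrow> nat \<Rightarrow> ('f::group_add \<Rightarrow>\<^sub>0 'k::{field,finite}) Matrix.vec set
      \<Rightarrow> (('f \<Rightarrow>\<^sub>0 'k) Matrix.vec \<Rightarrow> 'k Matrix.vec) pmf" where
  "random_hom s N M =
     bind_pmf (pmf_of_set (module_structures s N)) (\<lambda>act. pmf_of_set (module_homs s N act M))"

text \<open>The function is meaningful for submodules \<open>L \<subseteq> M\<close> with \<open>M\<close> free of finite rank.\<close>

definition phi ::
    "side \<Rightarrow> ('f::group_add \<Rightarrow>\<^sub>0 'k::{field,finite}) Matrix.vec set
      \<Rightarrow> ('f \<Rightarrow>\<^sub>0 'k) Matrix.vec set \<Rightarrow> nat \<Rightarrow> real" where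
  "phi s L M N =
     real CARD('k) ^ N * measure_pmf.prob (random_hom s N M) {\<phi>. L \<subseteq> {x \<in> M. \<phi> x = 0\<^sub>v N}}"

end

theory Submission
  imports Defs
begin

text \<open>
  Write $A = K[F]$.  An algebraic extension of the column module of $Q$ has a finite basis, and the only
  free factor of it that contains the column module is the extension itself.  So bases
  $f_1, \dots, f_l$ of $L$ and $g_1, \dots, g_t$ of $M$ give matrices with
  $Q = (f_j) B = (g_i) C$, the duals of $L$ and $M$ are the row modules of $B$ and $C$, and
  $L \le M$ yields a matrix $P$ with $(f_j) = (g_i) P$ and $C = P B$
  (\<open>alg_extension_dual\<close>, \<open>change_of_basis\<close>).

  If the rows of $B$ form a basis of the dual of $L$, both sides of the claim measure the same matrix $P$.
  For an action of $A$ on $K^N$, homomorphisms on $M$ that kill $L$ are the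
  solutions of a linear system with matrix $P$, each entry replaced by the matrix by which it acts.
  Homomorphisms on the dual of $L$ that kill the dual of $M$ are the solutions of
  the transposed system, if the action is replaced by its adjoint.  Both systems have the same rank,
  and the probability of being a solution is $q$ to the power of minus the rank.  Taking adjoints
  is a bijection between right and left module structures, so the averages agree.  Instead of
  ranks, the formal proof (\<open>hom_kernels_duality\<close>) uses a pairing between the two spaces of
  homomorphisms, whose two kernels are the two solution spaces: counting the zeros of the pairing in two ways shows
  that the kernels have the same density (\<open>pairing_kernels_card\<close>).

  It remains to see that the rows of $B$ are independent (\<open>dual_rows_independent\<close>).
  A relation between them is a nonzero functional on $L$ that kills the columns of $Q$.  If submodules
  of $A^n$ are free, then its image is free, its kernel is free and a direct summand,
  and hence the kernel is a proper free factor of $L$ containing the column module, which contradicts algebraicity.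

  That submodules of $A^n$ are free (\<open>submodule_free\<close>) reduces to right ideals by projecting to
  one coordinate at a time.  For a right ideal $N$ the Schreier method of Lewin applies: a maximal
  subtree $T$ of the Cayley graph of $F$ that is linearly independent modulo $N$ is a basis of $A / N$,
  and the edges that leave $T$ in the direction of a generator give a basis of $N$ (\<open>right_ideal_free\<close>).
  Independence is seen from Fox derivatives that are dual to these edges (\<open>derivation_exists\<close>).
\<close>

section \<open>Recursion and induction on free groups\<close>

lemma word_value_Nil [simp]: "word_value [] = 0"
  by (simp add: word_value_def)

lemma word_value_snoc [simp]:
  "word_value (w @ [(s, b)]) = word_value w + (if b then s else - s)"
  by (simp add: word_value_def)

lemma free_group_induct [consumes 1, case_names zero plus minus]:
  assumes "free_group_basis S"
    and "P 0"
    and plus: "\<And>g s. s \<in> S \<Longrightarrow> P g \<Longrightarrow> P (g + s)"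
    and minus: "\<And>g s. s \<in> S \<Longrightarrow> P g \<Longrightarrow> P (g - s)"
  shows "P g"
proof -
  have words: "set w \<subseteq> S \<times> UNIV \<Longrightarrow> P (word_value w)" for w
  proof (induction w rule: rev_induct)
    case Nil
    then show ?case using \<open>P 0\<close> by simp
  next
    case (snoc a w)
    then show ?case
      using plus[of "fst a" "word_value w"] minus[of "fst a" "word_value w"]
      by (cases a) (auto simp: diff_conv_add_uminus simp del: add_uminus_conv_diff)
  qed
  have "g \<in> word_value ` reduced_words S"
    using \<open>free_group_basis S\<close> by (simp add: free_group_basis_def bij_betw_def)
  then obtain w where "w \<in> reduced_words S" "word_value w = g" by blast
  then show ?thesis using words[of w] by (auto simp: reduced_words_def)
qed

text \<open>
  Evaluate the reduced word of an element letter by letter, a letter \<open>s\<close> acting by \<open>\<sigma> s\<close> and its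
  inverse by the inverse bijection.  Right multiplication by \<open>s\<close> either cancels a final inverse of \<open>s\<close>
  or appends \<open>s\<close> to the reduced word, and both cases act as \<open>\<sigma> s\<close>.  Uniqueness of reduced words enters
  the whole development only through this lemma.
\<close>
lemma free_group_recursion:
  assumes basis: "free_group_basis S"
    and bij: "\<And>s. s \<in> S \<Longrightarrow> bij (\<sigma> s)"
  shows "\<exists>f. f 0 = x0 \<and> (\<forall>g. \<forall>s\<in>S. f (g + s) = \<sigma> s (f g))"
proof -
  define step where "step x a = (if snd a then \<sigma> (fst a) x else inv_into UNIV (\<sigma> (fst a)) x)" for x a
  define wd where "wd = inv_into (reduced_words S) word_value"
  define f where "f g = foldl step x0 (wd g)" for g
  have wd: "wd g \<in> reduced_words S" "word_value (wd g) = g" for g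
    using basis inv_into_into[of g word_value "reduced_words S"]
      f_inv_into_f[of g word_value "reduced_words S"]
    unfolding wd_def free_group_basis_def bij_betw_def by auto
  have wd_eq: "wd (word_value w) = w" if "w \<in> reduced_words S" for w
    using basis that unfolding wd_def free_group_basis_def bij_betw_def by simp
  have "[] \<in> reduced_words S"
    by (simp add: reduced_words_def)
  then have "f 0 = x0"
    using wd_eq[of "[]"] by (simp add: f_def)
  moreover have "f (g + s) = \<sigma> s (f g)" if "s \<in> S" for g s
  proof (cases "\<exists>w. wd g = w @ [(s, False)]")
    case True
    then obtain w where w: "wd g = w @ [(s, False)]" by blast
    then have "w \<in> reduced_words S"
      using wd(1)[of g] by (auto simp: reduced_words_def successively_append_iff)
    moreover have "g + s = word_value w"
      using wd(2)[of g] w by auto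
    ultimately have "wd (g + s) = w"
      using wd_eq by simp
    moreover have "f g = inv_into UNIV (\<sigma> s) (foldl step x0 w)"
      using w by (simp add: f_def step_def)
    ultimately show ?thesis
      using bij[OF that] by (simp add: f_def bij_is_surj surj_f_inv_f)
  next
    case False
    have "wd g = [] \<or> last (wd g) \<noteq> (s, False)"
      using False by (metis append_butlast_last_id)
    then have "wd g @ [(s, True)] \<in> reduced_words S"
      using wd(1)[of g] that
      by (auto simp: reduced_words_def successively_append_iff prod_eq_iff)
    then have "wd (g + s) = wd g @ [(s, True)]"
      using wd_eq[of "wd g @ [(s, True)]"] wd(2)[of g] by simp
    then show ?thesis
      by (simp add: f_def step_def)
  qed
  ultimately show ?thesis by blast
qed

section \<open>Linear algebra in the group algebra\<close>

abbreviation mon :: "'f \<Rightarrow> 'f \<Rightarrow>\<^sub>0 'k::field" where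
  "mon g \<equiv> Poly_Mapping.single g 1"

abbreviation scal :: "'k::field \<Rightarrow> 'f::monoid_add \<Rightarrow>\<^sub>0 'k" where
  "scal c \<equiv> Poly_Mapping.single 0 c"

lemma mon_mult [simp]: "mon g * mon h = mon (g + h)"
  by (simp add: mult_single)

lemma poly_mapping_sum_singles:
  "p = (\<Sum>g\<in>Poly_Mapping.keys p. Poly_Mapping.single g (Poly_Mapping.lookup p g))"
proof (rule poly_mapping_eqI)
  fix h
  have "(\<Sum>g\<in>Poly_Mapping.keys p. Poly_Mapping.lookup p g when g = h) = Poly_Mapping.lookup p h"
    by (cases "h \<in> Poly_Mapping.keys p")
       (auto simp: when_def in_keys_iff)
  then show "Poly_Mapping.lookup p h =
      Poly_Mapping.lookup (\<Sum>g\<in>Poly_Mapping.keys p. Poly_Mapping.single g (Poly_Mapping.lookup p g)) h"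
    by (simp add: lookup_sum lookup_single)
qed

text \<open>
  The monomials are written as products rather than as \<open>Poly_Mapping.single g c\<close>, because the
  inductive proofs below treat the scalar and the group element by separate laws.
\<close>
lemma group_algebra_induct [case_names monomial add]:
  fixes P :: "('f::monoid_add \<Rightarrow>\<^sub>0 'k::field) \<Rightarrow> bool"
  assumes monomial: "\<And>g c. P (scal c * mon g)"
    and add: "\<And>p q. P p \<Longrightarrow> P q \<Longrightarrow> P (p + q)"
  shows "P p"
proof -
  have single: "P (Poly_Mapping.single g c)" for g c
    using monomial[of c g] by (simp add: mult_single)
  have "P 0" using single[of 0 0] by simp
  have "P (\<Sum>g\<in>X. Poly_Mapping.single g (Poly_Mapping.lookup p g))" if "finite X" for X
    using that by (induction X rule: finite_induct) (auto intro: single add \<open>P 0\<close>)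
  then show ?thesis
    by (subst poly_mapping_sum_singles) simp
qed

lemma scal_central: "scal c * p = p * scal c"
  by (induction p rule: group_algebra_induct) (auto simp: mult_single distrib_left distrib_right mult.commute)

interpretation KF: vector_space "\<lambda>c (p :: 'f::monoid_add \<Rightarrow>\<^sub>0 'k::field). scal c * p"
  by standard (simp_all add: distrib_left distrib_right single_add mult_single flip: mult.assoc)

lemma span_mon: "KF.span (range mon) = UNIV"
proof -
  have "p \<in> KF.span (range mon)" for p
  proof (induction p rule: group_algebra_induct)
    case (monomial g c)
    then show ?case by (intro KF.span_scale KF.span_base) simp
  qed (rule KF.span_add)
  then show ?thesis by blast
qed

section \<open>Right ideals of the group algebra are free\<close>

definition right_ideal :: "'a::ring_1 set \<Rightarrow> bool" where
  "right_ideal N \<longleftrightarrow> 0 \<in> N \<and> (\<forall>x\<in>N. \<forall>y\<in>N. x + y \<in> N) \<and> (\<forall>x\<in>N. \<forall>a. x * a \<in> N)"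

text \<open>
  That \<open>E\<close> generates \<open>N\<close> is expressed by minimality among the right ideals, so that no
  coefficients have to be produced.
\<close>
definition right_ideal_basis :: "'a::ring_1 set \<Rightarrow> 'a set \<Rightarrow> bool" where
  "right_ideal_basis N E \<longleftrightarrow> E \<subseteq> N \<and>
     (\<forall>X c. finite X \<and> X \<subseteq> E \<and> (\<Sum>v\<in>X. v * c v) = 0 \<longrightarrow> (\<forall>v\<in>X. c v = 0)) \<and>
     (\<forall>J. right_ideal J \<and> E \<subseteq> J \<longrightarrow> N \<subseteq> J)"

text \<open>
  The vertices of \<open>T\<close> that are joined to the neutral element by a path inside \<open>T\<close> in the Cayley
  graph, which is a tree.  Hence \<open>T \<subseteq> reach S T\<close> says that \<open>T\<close> is empty or a subtree containing the root.
\<close>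
inductive_set reach :: "'f::group_add set \<Rightarrow> 'f set \<Rightarrow> 'f set" for S T where
  zero: "0 \<in> T \<Longrightarrow> 0 \<in> reach S T"
| plus: "g \<in> reach S T \<Longrightarrow> s \<in> S \<Longrightarrow> g + s \<in> T \<Longrightarrow> g + s \<in> reach S T"
| minus: "g \<in> reach S T \<Longrightarrow> s \<in> S \<Longrightarrow> g - s \<in> T \<Longrightarrow> g - s \<in> reach S T"

lemma reach_subset: "reach S T \<subseteq> T"
  by (auto elim: reach.cases)

lemma reach_mono: "T \<subseteq> T' \<Longrightarrow> reach S T \<subseteq> reach S T'"
proof
  fix g assume "T \<subseteq> T'" "g \<in> reach S T"
  from this(2) show "g \<in> reach S T'"
    by induction (use \<open>T \<subseteq> T'\<close> in \<open>auto intro: reach.intros\<close>)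
qed

lemma right_ideal_subspace:
  fixes N :: "('f::monoid_add \<Rightarrow>\<^sub>0 'k::field) set"
  assumes "right_ideal N"
  shows "KF.subspace N"
  using assms unfolding KF.subspace_def right_ideal_def by (simp add: scal_central)

text \<open>
  A maximal subtree \<open>T\<close> whose vertices are linearly independent modulo \<open>N\<close> is a basis modulo \<open>N\<close>.
  Indeed, every neighbour in the Cayley graph of a vertex of \<open>T\<close> lies in the span \<open>U\<close> of \<open>T\<close> and \<open>N\<close>,
  since otherwise it could be added to \<open>T\<close>.  So \<open>U\<close> is stable under all generators and their
  inverses, and contains \<open>1\<close>, hence it is everything.  To stay inside vector space theory, \<open>N\<close> is
  represented by one of its bases \<open>BN\<close>.
\<close>
lemma schreier_transversal_exists:
  fixes N :: "('f::group_add \<Rightarrow>\<^sub>0 'k::field) set"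
  assumes basis: "free_group_basis S" and N: "right_ideal N"
  obtains T BN where "BN \<subseteq> N" "KF.span BN = N" "T \<subseteq> reach S T"
    "KF.independent (mon ` T \<union> BN)" "mon ` T \<inter> BN = {}" "KF.span (mon ` T \<union> BN) = UNIV"
proof -
  obtain BN where BN: "BN \<subseteq> N" "KF.independent BN" "N \<subseteq> KF.span BN"
    using KF.maximal_independent_subset by blast
  have span_BN: "KF.span BN = N"
    using BN KF.span_minimal[OF BN(1) right_ideal_subspace[OF N]] by blast
  define \<A> where "\<A> = {T. T \<subseteq> reach S T \<and> KF.independent (mon ` T \<union> BN) \<and> mon ` T \<inter> BN = {}}"
  have "{} \<in> \<A>" using BN by (simp add: \<A>_def)
  have "\<exists>T\<in>\<A>. \<forall>X\<in>\<A>. T \<subseteq> X \<longrightarrow> X = T"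
  proof (rule subset_Zorn_nonempty)
    show "\<A> \<noteq> {}" using \<open>{} \<in> \<A>\<close> by blast
    fix \<C> assume C: "\<C> \<noteq> {}" "subset.chain \<A> \<C>"
    then have sub: "T \<in> \<A>" if "T \<in> \<C>" for T
      using that by (auto simp: subset.chain_def)
    have "\<Union>\<C> \<subseteq> reach S (\<Union>\<C>)"
    proof
      fix g assume "g \<in> \<Union>\<C>"
      then obtain T where T: "T \<in> \<C>" "g \<in> T" by blast
      then have "g \<in> reach S T" using sub by (auto simp: \<A>_def)
      then show "g \<in> reach S (\<Union>\<C>)" using reach_mono[of T "\<Union>\<C>"] T(1) by blast
    qed
    moreover have "KF.independent (\<Union>T\<in>\<C>. mon ` T \<union> BN)"
    proof (rule KF.independent_Union_directed)
      fix c d assume "c \<in> (\<lambda>T. mon ` T \<union> BN) ` \<C>" "d \<in> (\<lambda>T. mon ` T \<union> BN) ` \<C>"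
      then obtain T1 T2 where "c = mon ` T1 \<union> BN" "d = mon ` T2 \<union> BN" "T1 \<in> \<C>" "T2 \<in> \<C>"
        by blast
      moreover have "T1 \<subseteq> T2 \<or> T2 \<subseteq> T1"
        using C(2) \<open>T1 \<in> \<C>\<close> \<open>T2 \<in> \<C>\<close> by (auto simp: subset.chain_def)
      ultimately show "c \<subseteq> d \<or> d \<subseteq> c" by blast
    qed (use sub in \<open>auto simp: \<A>_def\<close>)
    moreover have "(\<Union>T\<in>\<C>. mon ` T \<union> BN) = mon ` \<Union>\<C> \<union> BN"
      using C(1) by blast
    moreover have "mon ` \<Union>\<C> \<inter> BN = {}"
      using sub by (auto simp: \<A>_def)
    ultimately show "\<Union>\<C> \<in> \<A>" by (simp add: \<A>_def)
  qed
  then obtain T where T: "T \<in> \<A>" and max: "\<And>X. X \<in> \<A> \<Longrightarrow> T \<subseteq> X \<Longrightarrow> X = T" by blast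
  define U where "U = KF.span (mon ` T \<union> BN)"
  have extend: "mon g \<in> U" if "g \<in> reach S (insert g T)" for g
  proof (rule ccontr)
    assume g: "mon g \<notin> U"
    have "insert g T \<subseteq> reach S (insert g T)"
      using that T reach_mono[of T "insert g T" S] by (auto simp: \<A>_def)
    moreover have "KF.independent (mon ` insert g T \<union> BN)"
      using KF.independent_insertI[of "mon g" "mon ` T \<union> BN"] g T
      by (simp add: \<A>_def U_def)
    moreover have "mon ` insert g T \<inter> BN = {}"
      using g T by (auto simp: \<A>_def U_def intro: KF.span_base)
    ultimately have "insert g T = T"
      using max[of "insert g T"] by (auto simp: \<A>_def)
    then have "mon g \<in> U" unfolding U_def by (intro KF.span_base) blast
    then show False using g by blast
  qed
  have closed: "x * mon h \<in> U"
    if "x \<in> U" and *: "\<And>t. t \<in> T \<Longrightarrow> mon (t + h) \<in> U" for x h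
    using that(1) unfolding U_def
  proof (induction x rule: KF.span_induct_alt)
    case base
    then show ?case by (simp add: KF.span_zero)
  next
    case (step c x y)
    have "x * mon h \<in> U"
    proof (cases "x \<in> BN")
      case True
      then have "x * mon h \<in> N" using BN(1) N by (auto simp: right_ideal_def)
      then show ?thesis
        unfolding U_def span_BN[symmetric] using KF.span_mono[of BN "mon ` T \<union> BN"] by blast
    next
      case False
      then obtain t where "t \<in> T" "x = mon t" using step by blast
      then show ?thesis using * by simp
    qed
    then show ?case using step(2)
      by (simp add: distrib_right mult.assoc KF.span_add KF.span_scale U_def)
  qed
  have "mon g \<in> U" for g
    using basis
  proof (induction g rule: free_group_induct)
    case zero
    then show ?case by (intro extend reach.zero) simp
  next
    case (plus g s)
    have "mon (t + s) \<in> U" if "t \<in> T" for t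
    proof (rule extend, rule reach.plus)
      show "t \<in> reach S (insert (t + s) T)"
        using that T reach_mono[of T "insert (t + s) T" S] by (auto simp: \<A>_def)
    qed (use plus in auto)
    then show ?case using closed[OF plus(2), of s] by simp
  next
    case (minus g s)
    have "mon (t + - s) \<in> U" if "t \<in> T" for t
      unfolding add_uminus_conv_diff
    proof (rule extend, rule reach.minus)
      show "t \<in> reach S (insert (t - s) T)"
        using that T reach_mono[of T "insert (t - s) T" S] by (auto simp: \<A>_def)
    qed (use minus in auto)
    then show ?case using closed[OF minus(2), of "- s"] by simp
  qed
  then have "KF.span (range mon) \<subseteq> U"
    unfolding U_def by (intro KF.span_minimal) auto
  then have "U = UNIV" using span_mon by blast
  then show ?thesis
    using that[of BN T] BN span_BN T by (auto simp: \<A>_def U_def)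
qed

interpretation KFP: vector_space_pair
  "\<lambda>c (p :: 'f::monoid_add \<Rightarrow>\<^sub>0 'k::field). scal c * p"
  "\<lambda>c (p :: 'f::monoid_add \<Rightarrow>\<^sub>0 'k::field). scal c * p" ..

lemma mon_eq_iff [simp]: "(mon g :: 'f \<Rightarrow>\<^sub>0 'k::field) = mon h \<longleftrightarrow> g = h"
  by (metis lookup_single_eq lookup_single_not_eq zero_neq_one)

lemma linear_extension_of_group_map:
  fixes d :: "'f::monoid_add \<Rightarrow> 'f \<Rightarrow>\<^sub>0 'k::field"
  obtains D where "\<And>p q. D (p + q) = D p + D q" "\<And>c p. D (scal c * p) = scal c * D p"
    "\<And>g. D (mon g) = d g"
proof -
  define D where "D p = Sum_any (\<lambda>g. scal (Poly_Mapping.lookup p g) * d g)" for p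
  have fin: "finite {g. scal (Poly_Mapping.lookup p g) * d g \<noteq> 0}" for p
    by (rule finite_subset[OF _ finite_keys[of p]]) (auto simp: in_keys_iff)
  have "D (p + q) = D p + D q" for p q
    unfolding D_def by (simp add: lookup_add single_add distrib_right Sum_any.distrib fin)
  moreover have "D (scal c * p) = scal c * D p" for c p
  proof -
    have "Poly_Mapping.lookup (scal c * p) g = c * Poly_Mapping.lookup p g" for g
      by (simp add: Poly_Mapping.map.rep_eq when_def flip: mult_map_scale_conv_mult)
    then have "D (scal c * p) = Sum_any (\<lambda>g. scal c * (scal (Poly_Mapping.lookup p g) * d g))"
      unfolding D_def by (simp add: mult_single flip: mult.assoc)
    then show ?thesis
      unfolding D_def using Sum_any_right_distrib[OF fin, of "scal c" p] by simp
  qed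
  moreover have "D (mon g) = d g" for g
  proof -
    have "scal (Poly_Mapping.lookup (mon g) h) * d h = (d h when h = g)" for h
      by (auto simp: lookup_single when_def)
    then show ?thesis unfolding D_def by simp
  qed
  ultimately show ?thesis using that by blast
qed

text \<open>
  Lewin's form of the Schreier method.  The vertices of the tree \<open>T\<close> represent a basis of \<open>A / N\<close>;
  each edge from a vertex \<open>t\<close> of \<open>T\<close> to a vertex \<open>t + s\<close> outside \<open>T\<close>, with \<open>s\<close> a generator, gives one
  element of a basis of \<open>N\<close>.
  The case \<open>0 \<notin> T\<close> is excluded here, it only occurs if \<open>N\<close> is the whole algebra.
\<close>
locale schreier_transversal =
  fixes S :: "'f::group_add set" and N BN :: "('f \<Rightarrow>\<^sub>0 'k::field) set" and T :: "'f set"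
  assumes free_basis: "free_group_basis S"
    and N: "right_ideal N"
    and span_BN: "KF.span BN = N"
    and T_reach: "T \<subseteq> reach S T"
    and zero_T: "0 \<in> T"
    and indep: "KF.independent (mon ` T \<union> BN)"
    and disjoint: "mon ` T \<inter> BN = {}"
    and spanning: "KF.span (mon ` T \<union> BN) = UNIV"
begin

text \<open>
  The projection along \<open>N\<close> onto the span of the tree, and the coordinates with respect to its vertices.
\<close>
definition proj :: "('f \<Rightarrow>\<^sub>0 'k) \<Rightarrow> 'f \<Rightarrow>\<^sub>0 'k" where
  "proj = KFP.construct (mon ` T \<union> BN) (\<lambda>b. if b \<in> mon ` T then b else 0)"

definition coord :: "'f \<Rightarrow> ('f \<Rightarrow>\<^sub>0 'k) \<Rightarrow> 'k" where
  "coord t x = KF.representation (mon ` T \<union> BN) x (mon t)"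

text \<open>
  The element of \<open>N\<close> that belongs to the edge from \<open>t\<close> to \<open>t + s\<close>.  Edges that leave the tree along the
  inverse of a generator contribute nothing new, as the proof of \<open>schreier_basis_spans\<close> shows.
\<close>
definition gen :: "'f \<Rightarrow> 'f \<Rightarrow> 'f \<Rightarrow>\<^sub>0 'k" where
  "gen t s = mon (t + s) - proj (mon (t + s))"

definition schreier_basis :: "('f \<Rightarrow>\<^sub>0 'k) set" where
  "schreier_basis = {gen t s |t s. t \<in> T \<and> s \<in> S \<and> t + s \<notin> T}"

lemma proj_linear: "Vector_Spaces.linear (\<lambda>c (p :: 'f \<Rightarrow>\<^sub>0 'k). scal c * p) (\<lambda>c (p :: 'f \<Rightarrow>\<^sub>0 'k). scal c * p) proj"
  unfolding proj_def by (rule KFP.linear_construct[OF indep])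

lemma proj_add: "proj (x + y) = proj x + proj y"
  using KFP.linear_add[OF proj_linear] .

lemma proj_diff: "proj (x - y) = proj x - proj y"
  using KFP.linear_diff[OF proj_linear] .

lemma proj_scale: "proj (scal c * x) = scal c * proj x"
  using KFP.linear_scale[OF proj_linear] .

lemma proj_mon: "t \<in> T \<Longrightarrow> proj (mon t) = mon t"
  unfolding proj_def by (subst KFP.construct_basis[OF indep]) auto

lemma proj_ideal: "x \<in> N \<Longrightarrow> proj x = 0"
  unfolding span_BN[symmetric]
proof (induction x rule: KF.span_induct_alt)
  case base
  then show ?case using KFP.linear_0[OF proj_linear] .
next
  case (step c b y)
  then have "proj b = 0"
    unfolding proj_def using disjoint by (subst KFP.construct_basis[OF indep]) auto
  then show ?case using step by (simp add: proj_add proj_scale)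
qed

lemma proj_in_span: "proj x \<in> KF.span (mon ` T)"
proof -
  have "x \<in> KF.span (mon ` T \<union> BN)" using spanning by blast
  then show ?thesis
  proof (induction x rule: KF.span_induct_alt)
    case base
    then show ?case by (simp add: KFP.linear_0[OF proj_linear] KF.span_zero)
  next
    case (step c b y)
    have "proj b \<in> KF.span (mon ` T)"
    proof (cases "b \<in> mon ` T")
      case True
      then show ?thesis by (auto simp: proj_mon intro: KF.span_base)
    next
      case False
      then have "b \<in> N" using step span_BN KF.span_base by blast
      then show ?thesis by (simp add: proj_ideal KF.span_zero)
    qed
    then show ?case using step
      unfolding proj_add proj_scale by (intro KF.span_add KF.span_scale) auto
  qed
qed

lemma proj_cong_ideal: "x - proj x \<in> N"
proof -
  have "x \<in> KF.span (mon ` T \<union> BN)" using spanning by blast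
  then show ?thesis
  proof (induction x rule: KF.span_induct_alt)
    case base
    then show ?case using N by (simp add: KFP.linear_0[OF proj_linear] right_ideal_def)
  next
    case (step c b y)
    have "b - proj b \<in> N"
    proof (cases "b \<in> mon ` T")
      case True
      then show ?thesis using N by (auto simp: proj_mon right_ideal_def)
    next
      case False
      then have "b \<in> N" using step span_BN KF.span_base by blast
      then show ?thesis by (simp add: proj_ideal)
    qed
    then have "scal c * (b - proj b) + (y - proj y) \<in> N"
      using step right_ideal_subspace[OF N] by (simp add: KF.subspace_add KF.subspace_scale)
    then show ?case by (simp add: proj_add proj_scale algebra_simps)
  qed
qed

lemma coord_add: "coord t (x + y) = coord t x + coord t y"
  unfolding coord_def using KF.representation_add[OF indep, of y x] spanning by simp

lemma coord_scale: "coord t (scal c * x) = c * coord t x"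
  unfolding coord_def using KF.representation_scale[OF indep, of x c] spanning by simp

lemma coord_mon: "t \<in> T \<Longrightarrow> coord t' (mon t) = (if t = t' then 1 else 0)"
  unfolding coord_def using KF.representation_basis[OF indep, of "mon t"] by auto

lemma coord_ideal: "x \<in> N \<Longrightarrow> t \<in> T \<Longrightarrow> coord t x = 0"
  unfolding coord_def
  using KF.representation_extend[OF indep, of x BN] KF.representation_ne_zero[of BN x "mon t"]
    span_BN disjoint by auto

lemma gen_in_ideal: "gen t s \<in> N"
  unfolding gen_def by (rule proj_cong_ideal)

text \<open>
  The functional dual to the edge from \<open>t0\<close> to \<open>t0 + s0\<close>.  It is a Fox derivative with values twisted by the
  coordinate at \<open>t0\<close>: the rule \<open>D (x s) = D x s + [s = s0] coord t0 x\<close> together with \<open>D 1 = 0\<close>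
  determines \<open>D\<close>, and a free group imposes no further condition.  It vanishes on the tree, because
  a path inside the tree never passes through this edge, and it is right linear on \<open>N\<close>, because the
  coordinates vanish there.
\<close>
lemma derivation_exists:
  assumes "t0 \<in> T" "s0 \<in> S" "t0 + s0 \<notin> T"
  obtains D where "\<And>x y. D (x + y) = D x + D y" "\<And>x a. x \<in> N \<Longrightarrow> D (x * a) = D x * a"
    "D (gen t0 s0) = 1"
    "\<And>t s. t \<in> T \<Longrightarrow> s \<in> S \<Longrightarrow> (t, s) \<noteq> (t0, s0) \<Longrightarrow> D (gen t s) = 0"
proof -
  define \<delta> :: "'f \<Rightarrow> ('f \<Rightarrow>\<^sub>0 'k) \<Rightarrow> 'f \<Rightarrow>\<^sub>0 'k" where "\<delta> s x = (if s = s0 then scal (coord t0 x) else 0)" for s x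
  \<comment> \<open>The rule for \<open>D (x s)\<close> involves \<open>x\<close> itself, so the recursion runs over pairs of a group
    element \<open>g\<close> and the value at \<open>g\<close>.\<close>
  define \<sigma> where "\<sigma> s = (\<lambda>(g, a). (g + s, a * mon s + \<delta> s (mon g)))" for s
  have fst_\<sigma>: "fst (\<sigma> s x) = fst x + s" for s x
    by (simp add: \<sigma>_def split_beta)
  have snd_\<sigma>: "snd (\<sigma> s x) = snd x * mon s + \<delta> s (mon (fst x))" for s x
    by (simp add: \<sigma>_def split_beta)
  have bij: "bij (\<sigma> s)" for s
  proof (rule bijI')
    show "\<sigma> s x = \<sigma> s y \<longleftrightarrow> x = y" for x y
    proof
      assume eq: "\<sigma> s x = \<sigma> s y"
      then have "fst x = fst y" by (auto simp: \<sigma>_def split: prod.splits)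
      moreover from this eq have "snd x * mon s = snd y * mon s"
        by (auto simp: \<sigma>_def split: prod.splits)
      then have "(snd x * mon s) * mon (- s) = (snd y * mon s) * mon (- s)" by simp
      then have "snd x = snd y" by (simp add: mult.assoc)
      ultimately show "x = y" by (simp add: prod_eq_iff)
    qed auto
    show "\<exists>x. y = \<sigma> s x" for y
      by (rule exI[of _ "(fst y - s, (snd y - \<delta> s (mon (fst y - s))) * mon (- s))"])
         (simp add: \<sigma>_def mult.assoc prod_eq_iff)
  qed
  have "\<exists>f. f 0 = (0, 0) \<and> (\<forall>g. \<forall>s\<in>S. f (g + s) = \<sigma> s (f g))"
    by (rule free_group_recursion[OF free_basis bij])
  then obtain f where f: "f 0 = (0, 0)" "\<And>g s. s \<in> S \<Longrightarrow> f (g + s) = \<sigma> s (f g)"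
    by blast
  have fst_f: "fst (f g) = g" for g
    using free_basis
  proof (induction g rule: free_group_induct)
    case zero
    then show ?case by (simp add: f)
  next
    case (plus g s)
    then show ?case by (simp add: f fst_\<sigma>)
  next
    case (minus g s)
    then have "f g = \<sigma> s (f (g - s))" using f(2)[of s "g - s"] by simp
    then have "fst (f (g - s)) + s = fst (f g)" by (simp add: fst_\<sigma>)
    then show ?case using minus by (metis add_diff_cancel)
  qed
  obtain D where D_add: "\<And>p q. D (p + q) = D p + D q"
    and D_scale: "\<And>c p. D (scal c * p) = scal c * D p"
    and D_mon: "\<And>g. D (mon g) = snd (f g)"
    using linear_extension_of_group_map[of "\<lambda>g. snd (f g)"] by blast
  have D_0: "D 0 = 0" using D_add[of 0 0] by simp
  have D_diff: "D (x - y) = D x - D y" for x y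
    using D_add[of "x - y" y] by simp
  have \<delta>_add: "\<delta> s (x + y) = \<delta> s x + \<delta> s y" for s x y
    by (simp add: \<delta>_def coord_add single_add)
  have \<delta>_scale: "\<delta> s (scal c * x) = scal c * \<delta> s x" for s c x
    by (simp add: \<delta>_def coord_scale mult_single)
  have D_step: "D (x * mon s) = D x * mon s + \<delta> s x" if "s \<in> S" for x s
  proof (induction x rule: group_algebra_induct)
    case (monomial g c)
    have "D (mon g * mon s) = D (mon g) * mon s + \<delta> s (mon g)"
      using f(2)[OF that, of g] fst_f[of g] by (simp add: D_mon snd_\<sigma>)
    then have "D (scal c * (mon g * mon s)) = scal c * (D (mon g) * mon s + \<delta> s (mon g))"
      by (simp only: D_scale)
    also have "\<dots> = D (scal c * mon g) * mon s + \<delta> s (scal c * mon g)"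
      by (simp only: D_scale distrib_left mult.assoc \<delta>_scale)
    finally show ?case by (simp only: mult.assoc)
  next
    case (add p q)
    then show ?case by (simp add: distrib_right D_add \<delta>_add)
  qed
  have D_T: "D (mon t) = 0" if "t \<in> reach S T" for t
    using that
  proof induction
    case zero
    then show ?case using D_mon[of 0] f(1) by simp
  next
    case (plus g s)
    then have "\<delta> s (mon g) = 0"
      using reach_subset[of S T] assms by (auto simp: \<delta>_def coord_mon)
    then show ?case using D_step[OF plus(2), of "mon g"] plus by simp
  next
    case (minus g s)
    have "g \<in> T" using minus reach_subset by blast
    then have "\<delta> s (mon (g - s)) = 0"
      using minus assms coord_mon[of "g - s" t0] by (auto simp: \<delta>_def)
    then have "D (mon (g - s)) * mon s = 0"
      using D_step[OF minus(2), of "mon (g - s)"] minus by simp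
    then have "D (mon (g - s)) * mon s * mon (- s) = 0" by simp
    then show ?case by (simp add: mult.assoc)
  qed
  have D_proj: "D (proj x) = 0" for x
    using proj_in_span
  proof (induction rule: KF.span_induct_alt)
    case base
    then show ?case by (rule D_0)
  next
    case (step c x y)
    then show ?case using D_T T_reach by (auto simp: D_add D_scale)
  qed
  have D_gen: "D (gen t s) = \<delta> s (mon t)" if "t \<in> T" "s \<in> S" for t s
    using D_step[OF that(2), of "mon t"] D_T T_reach that(1)
    by (simp add: gen_def D_diff D_proj subset_iff)
  have D_ideal_mon: "D (x * mon g) = D x * mon g" if "x \<in> N" for x g
    using free_basis
  proof (induction g rule: free_group_induct)
    case zero
    then show ?case by simp
  next
    case (plus g s)
    have "\<delta> s (x * mon g) = 0"
      using that N assms by (simp add: \<delta>_def coord_ideal right_ideal_def)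
    then show ?case using D_step[OF plus(1), of "x * mon g"] plus(2) by (simp add: mult.assoc)
  next
    case (minus g s)
    have "\<delta> s (x * mon (g - s)) = 0"
      using that N assms by (simp add: \<delta>_def coord_ideal right_ideal_def)
    then have "D x * mon g = D (x * mon (g - s)) * mon s"
      using D_step[OF minus(1), of "x * mon (g - s)"] minus(2) by (simp add: mult.assoc)
    then have "D x * mon g * mon (- s) = D (x * mon (g - s)) * mon s * mon (- s)" by simp
    then show ?case by (simp add: mult.assoc)
  qed
  have "D (x * a) = D x * a" if "x \<in> N" for x a
  proof (induction a rule: group_algebra_induct)
    case (monomial g c)
    have swap: "y * (scal c * mon g) = scal c * (y * mon g)" for y :: "'f \<Rightarrow>\<^sub>0 'k"
      using scal_central[of c y] by (simp only: mult.assoc[symmetric])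
    show ?case
      by (simp only: swap D_scale D_ideal_mon[OF that])
  next
    case (add p q)
    then show ?case by (simp add: distrib_left D_add)
  qed
  moreover have "D (gen t0 s0) = 1"
    using assms by (simp add: D_gen \<delta>_def coord_mon)
  moreover have "D (gen t s) = 0" if "t \<in> T" "s \<in> S" "(t, s) \<noteq> (t0, s0)" for t s
    using that by (auto simp: D_gen \<delta>_def coord_mon)
  ultimately show ?thesis using that D_add by blast
qed

lemma schreier_basis_independent:
  assumes X: "finite X" "X \<subseteq> schreier_basis" and rel: "(\<Sum>v\<in>X. v * c v) = 0" and "w \<in> X"
  shows "c w = 0"
proof -
  obtain t0 s0 where w: "w = gen t0 s0" and ts: "t0 \<in> T" "s0 \<in> S" "t0 + s0 \<notin> T"
    using X \<open>w \<in> X\<close> by (auto simp: schreier_basis_def)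
  obtain D where D: "\<And>x y. D (x + y) = D x + D y" "\<And>x a. x \<in> N \<Longrightarrow> D (x * a) = D x * a"
    "D (gen t0 s0) = 1" "\<And>t s. t \<in> T \<Longrightarrow> s \<in> S \<Longrightarrow> (t, s) \<noteq> (t0, s0) \<Longrightarrow> D (gen t s) = 0"
    using derivation_exists[OF ts] by blast
  have "D 0 = 0" using D(1)[of 0 0] by simp
  then have "D (\<Sum>v\<in>X. v * c v) = (\<Sum>v\<in>X. D (v * c v))"
    using sum_comp_morphism[of D "\<lambda>v. v * c v" X] D(1) by (simp add: o_def)
  also have "\<dots> = (\<Sum>v\<in>X. if v = w then c v else 0)"
  proof (rule sum.cong[OF refl])
    fix v assume "v \<in> X"
    then obtain t s where v: "v = gen t s" "t \<in> T" "s \<in> S"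
      using X by (auto simp: schreier_basis_def)
    then show "D (v * c v) = (if v = w then c v else 0)"
      using D(2)[OF gen_in_ideal, of t s "c v"] D(3) D(4)[of t s] w by (cases "(t, s) = (t0, s0)") auto
  qed
  also have "\<dots> = c w" using X \<open>w \<in> X\<close> by simp
  finally show ?thesis using rel \<open>D 0 = 0\<close> by simp
qed

text \<open>
  Modulo \<open>J\<close>, every element is congruent to its projection to the span of the tree.  This is clear for the
  neutral element and propagates along edges: for \<open>s\<close> in \<open>S\<close> the difference is a combination of
  the generators, and for an inverse letter one multiplies by \<open>s\<close>, uses the first case, and
  multiplies back.  An element of \<open>N\<close> has projection \<open>0\<close>, so it lies in \<open>J\<close>.
\<close>
lemma schreier_basis_spans:
  assumes J: "right_ideal J" "schreier_basis \<subseteq> J"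
  shows "N \<subseteq> J"
proof -
  have J_sub: "KF.subspace J" by (rule right_ideal_subspace[OF J(1)])
  have J_mult: "x * a \<in> J" if "x \<in> J" for x a using J(1) that by (auto simp: right_ideal_def)
  have J0: "0 \<in> J" using J(1) by (auto simp: right_ideal_def)
  define \<nu> where "\<nu> x = x - proj x" for x
  have \<nu>_add: "\<nu> (x + y) = \<nu> x + \<nu> y" for x y by (simp add: \<nu>_def proj_add)
  have \<nu>_diff: "\<nu> (x - y) = \<nu> x - \<nu> y" for x y by (simp add: \<nu>_def proj_diff)
  have \<nu>_scale: "\<nu> (scal c * x) = scal c * \<nu> x" for c x
    by (simp add: \<nu>_def proj_scale right_diff_distrib)
  have \<nu>_T: "\<nu> (mon t) = 0" if "t \<in> T" for t using that by (simp add: \<nu>_def proj_mon)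
  have \<nu>_N: "\<nu> x = x" if "x \<in> N" for x using that by (simp add: \<nu>_def proj_ideal)
  have step: "\<nu> (x * mon h) \<in> J"
    if x: "\<nu> x \<in> J" and edges: "\<And>t. t \<in> T \<Longrightarrow> \<nu> (mon (t + h)) \<in> J" for x h
  proof -
    have span: "\<nu> (y * mon h) \<in> J" if "y \<in> KF.span (mon ` T)" for y
      using that
    proof (induction y rule: KF.span_induct_alt)
      case base
      then show ?case using J0 proj_ideal[of 0] N by (simp add: \<nu>_def right_ideal_def)
    next
      case (step c y z)
      then have "\<nu> (y * mon h) \<in> J" using edges by auto
      then show ?case
        using step J_sub
        by (simp add: distrib_right \<nu>_add \<nu>_scale mult.assoc KF.subspace_add KF.subspace_scale)
    qed
    have "x * mon h = \<nu> x * mon h + proj x * mon h" by (simp add: \<nu>_def left_diff_distrib)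
    moreover have "\<nu> x * mon h \<in> N"
      using proj_cong_ideal[of x] N by (simp add: \<nu>_def right_ideal_def)
    ultimately have "\<nu> (x * mon h) = \<nu> x * mon h + \<nu> (proj x * mon h)"
      by (simp add: \<nu>_add \<nu>_N)
    then show ?thesis
      using J_mult[OF x] span[OF proj_in_span] J_sub by (simp add: KF.subspace_add)
  qed
  have edge_plus: "\<nu> (mon (t + s)) \<in> J" if "t \<in> T" "s \<in> S" for t s
  proof (cases "t + s \<in> T")
    case True
    then show ?thesis using J0 by (simp add: \<nu>_T)
  next
    case False
    then show ?thesis using J(2) that by (auto simp: \<nu>_def schreier_basis_def gen_def)
  qed
  have edge_minus: "\<nu> (mon (t + - s)) \<in> J" if "t \<in> T" "s \<in> S" for t s
  proof -
    \<comment> \<open>Multiplied by \<open>s\<close>, the difference for \<open>t - s\<close> becomes one that the positive edges control.\<close>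
    define y where "y = proj (mon (t + - s))"
    have "\<nu> y = 0" unfolding y_def using proj_in_span
    proof (induction rule: KF.span_induct_alt)
      case base
      then show ?case using proj_ideal[of 0] N by (simp add: \<nu>_def right_ideal_def)
    next
      case (step c x z)
      then show ?case by (auto simp: \<nu>_add \<nu>_scale \<nu>_T)
    qed
    then have y: "\<nu> (y * mon s) \<in> J"
      using step[of y s] edge_plus that(2) J0 by simp
    have *: "\<nu> (mon (t + - s)) * mon s = mon t - y * mon s"
      by (simp add: \<nu>_def y_def left_diff_distrib)
    have "\<nu> (mon (t + - s)) * mon s \<in> N"
      using proj_cong_ideal N by (simp add: \<nu>_def right_ideal_def)
    then have "\<nu> (mon (t + - s)) * mon s = \<nu> (mon t - y * mon s)"
      using * \<nu>_N by metis
    also have "\<dots> = 0 - \<nu> (y * mon s)"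
      using that(1) by (simp add: \<nu>_diff \<nu>_T)
    also have "\<dots> \<in> J" using J0 y J_sub by (intro KF.subspace_diff)
    finally have "\<nu> (mon (t + - s)) * mon s * mon (- s) \<in> J" by (rule J_mult)
    then show ?thesis by (simp add: mult.assoc)
  qed
  have mon_J: "\<nu> (mon g) \<in> J" for g
    using free_basis
  proof (induction g rule: free_group_induct)
    case zero
    then show ?case using \<nu>_T[OF zero_T] J0 by simp
  next
    case (plus g s)
    then show ?case using step[of "mon g" s] edge_plus by simp
  next
    case (minus g s)
    then show ?case using step[of "mon g" "- s"] edge_minus by simp
  qed
  have "\<nu> x \<in> J" for x
  proof (induction x rule: group_algebra_induct)
    case (monomial g c)
    then show ?case
      unfolding \<nu>_scale by (intro KF.subspace_scale[OF J_sub] mon_J)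
  next
    case (add p q)
    then show ?case using J_sub by (simp add: \<nu>_add KF.subspace_add)
  qed
  then show ?thesis using \<nu>_N by (metis subsetI)
qed

end

theorem right_ideal_free:
  fixes S :: "'f::group_add set" and N :: "('f \<Rightarrow>\<^sub>0 'k::field) set"
  assumes basis: "free_group_basis S" and N: "right_ideal N"
  shows "\<exists>E. right_ideal_basis N E"
proof -
  obtain T and BN :: "('f \<Rightarrow>\<^sub>0 'k) set" where T: "BN \<subseteq> N" "KF.span BN = N" "T \<subseteq> reach S T"
    "KF.independent (mon ` T \<union> BN)" "mon ` T \<inter> BN = {}" "KF.span (mon ` T \<union> BN) = UNIV"
    by (rule schreier_transversal_exists[OF basis N])
  show ?thesis
  proof (cases "0 \<in> T")
    case True
    interpret schreier_transversal S N BN T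
      by (rule schreier_transversal.intro) (fact basis N T True)+
    have "right_ideal_basis N schreier_basis"
      unfolding right_ideal_basis_def
      using gen_in_ideal schreier_basis_independent schreier_basis_spans
      by (auto simp: schreier_basis_def)
    then show ?thesis by blast
  next
    case False
    \<comment> \<open>Without the root, the subtree is empty, so \<open>1\<close> lies in \<open>N\<close>.\<close>
    have "0 \<in> T" if "t \<in> reach S T" for t
      using that by induction
    then have "T = {}" using T(3) False by blast
    then have "N = UNIV" using T(2,6) by simp
    moreover have "right_ideal_basis (UNIV :: ('f \<Rightarrow>\<^sub>0 'k) set) {1}"
    proof -
      have "c v = 0" if "X \<subseteq> {1}" "(\<Sum>v\<in>X. v * c v) = 0" "v \<in> X"
        for X and v :: "'f \<Rightarrow>\<^sub>0 'k" and c
      proof -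
        have "X = {1}" "v = 1" using that by auto
        then show ?thesis using that(2) by simp
      qed
      moreover have "UNIV \<subseteq> J" if "right_ideal J" "1 \<in> J" for J :: "('f \<Rightarrow>\<^sub>0 'k) set"
        using that by (metis UNIV_I mult_1 right_ideal_def subsetI)
      ultimately show ?thesis by (auto simp: right_ideal_basis_def)
    qed
    ultimately show ?thesis by blast
  qed
qed

section \<open>Linear combinations and coordinates\<close>

text \<open>
  With this product, scalars compose in the same way on both sides:
  \<open>a (b v) = (side_mult s a b) v\<close>.
\<close>
definition side_mult :: "side \<Rightarrow> 'a::semigroup_mult \<Rightarrow> 'a \<Rightarrow> 'a" where
  "side_mult s a b = (case s of LeftSide \<Rightarrow> a * b | RightSide \<Rightarrow> b * a)"

lemma side_mult_ring [simp]:
  fixes a b c :: "'a::ring_1"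
  shows "side_mult s (a + b) c = side_mult s a c + side_mult s b c"
    "side_mult s a (b + c) = side_mult s a b + side_mult s a c"
    "side_mult s 0 c = 0" "side_mult s a 0 = 0" "side_mult s 1 c = c" "side_mult s a 1 = a"
    "side_mult s (- a) c = - side_mult s a c"
  by (cases s; simp add: side_mult_def distrib_left distrib_right)+

lemma side_mult_assoc: "side_mult s (side_mult s a b) c = side_mult s a (side_mult s b c)"
  by (cases s) (simp_all add: side_mult_def mult.assoc)

lemma side_mult_sum:
  fixes a :: "'a::ring_1"
  shows "side_mult s a (sum f X) = (\<Sum>x\<in>X. side_mult s a (f x))"
  by (cases s) (simp_all add: side_mult_def sum_distrib_left sum_distrib_right)

lemma side_scale_conv: "side_scale s a v = map_vec (side_mult s a) v"
  by (cases s) (auto intro!: eq_vecI simp: side_mult_def)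

lemma side_scale_carrier [simp]: "side_scale s a v \<in> carrier_vec n \<longleftrightarrow> v \<in> carrier_vec n"
  by (simp add: side_scale_conv)

lemma side_scale_index [simp]: "i < dim_vec v \<Longrightarrow> side_scale s a v $ i = side_mult s a (v $ i)"
  by (simp add: side_scale_conv)

lemma side_scale_dim [simp]: "dim_vec (side_scale s a v) = dim_vec v"
  by (simp add: side_scale_conv)

lemma lin_comb_carrier [simp]: "X \<subseteq> carrier_vec n \<Longrightarrow> lin_comb s n c X \<in> carrier_vec n"
  unfolding lin_comb_def by (rule finsum_vec_closed) auto

lemma lin_comb_dim [simp]: "X \<subseteq> carrier_vec n \<Longrightarrow> dim_vec (lin_comb s n c X) = n"
  by (rule carrier_vecD) simp

lemma lin_comb_index:
  assumes "finite X" "X \<subseteq> carrier_vec n" "i < n"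
  shows "lin_comb s n c X $ i = (\<Sum>v\<in>X. side_mult s (c v) (v $ i))"
proof -
  have "lin_comb s n c X $ i = (\<Sum>v\<in>X. side_scale s (c v) v $ i)"
    unfolding lin_comb_def using assms by (intro index_finsum_vec) auto
  then show ?thesis using assms by (auto intro!: sum.cong side_scale_index)
qed

lemma lin_comb_empty [simp]: "lin_comb s n c {} = 0\<^sub>v n"
  by (simp add: lin_comb_def finsum_vec_empty)

lemma lin_comb_insert:
  assumes "finite X" "v \<notin> X" "insert v X \<subseteq> carrier_vec n"
  shows "lin_comb s n c (insert v X) = side_scale s (c v) v + lin_comb s n c X"
  by (rule eq_vecI) (use assms in \<open>auto simp: lin_comb_index\<close>)

lemma lin_comb_cong_neutral:
  assumes "finite Y" "Y \<subseteq> carrier_vec n" "X \<subseteq> Y" "\<And>v. v \<in> X \<Longrightarrow> d v = c v"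
    "\<And>v. v \<in> Y - X \<Longrightarrow> d v = 0"
  shows "lin_comb s n d Y = lin_comb s n c X"
proof (rule eq_vecI)
  have X: "finite X" "X \<subseteq> carrier_vec n" using assms finite_subset by auto
  then show "dim_vec (lin_comb s n d Y) = dim_vec (lin_comb s n c X)" using assms by simp
  fix i assume "i < dim_vec (lin_comb s n c X)"
  then have "i < n" using X by simp
  have "(\<Sum>v\<in>Y. side_mult s (d v) (v $ i)) = (\<Sum>v\<in>X. side_mult s (d v) (v $ i))"
    using assms by (intro sum.mono_neutral_right) auto
  also have "\<dots> = (\<Sum>v\<in>X. side_mult s (c v) (v $ i))"
    using assms by (intro sum.cong) auto
  finally show "lin_comb s n d Y $ i = lin_comb s n c X $ i"
    using assms X \<open>i < n\<close> by (simp add: lin_comb_index)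
qed

lemma lin_comb_add:
  assumes "finite X" "X \<subseteq> carrier_vec n"
  shows "lin_comb s n c X + lin_comb s n d X = lin_comb s n (\<lambda>v. c v + d v) X"
  by (rule eq_vecI) (use assms in \<open>auto simp: lin_comb_index sum.distrib\<close>)

lemma lin_comb_scale:
  assumes "finite X" "X \<subseteq> carrier_vec n"
  shows "side_scale s a (lin_comb s n c X) = lin_comb s n (\<lambda>v. side_mult s a (c v)) X"
  by (rule eq_vecI) (use assms in \<open>auto simp: lin_comb_index side_mult_sum side_mult_assoc\<close>)

lemma submodule_carrier: "submodule s n M \<Longrightarrow> M \<subseteq> carrier_vec n"
  by (simp add: submodule_def)

lemma submodule_zero: "submodule s n M \<Longrightarrow> 0\<^sub>v n \<in> M"
  by (simp add: submodule_def)

lemma submodule_add: "submodule s n M \<Longrightarrow> x \<in> M \<Longrightarrow> y \<in> M \<Longrightarrow> x + y \<in> M"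
  by (simp add: submodule_def)

lemma submodule_scale: "submodule s n M \<Longrightarrow> x \<in> M \<Longrightarrow> side_scale s a x \<in> M"
  by (simp add: submodule_def)

lemma submodule_diff:
  assumes "submodule s n M" "x \<in> M" "y \<in> M"
  shows "x - y \<in> M"
proof -
  have "x - y = x + side_scale s (-1) y"
    by (rule eq_vecI) (use assms submodule_carrier in \<open>fastforce+\<close>)
  then show ?thesis using assms by (simp add: submodule_add submodule_scale)
qed

lemma submodule_lin_comb:
  assumes "submodule s n M" "finite X" "X \<subseteq> M"
  shows "lin_comb s n c X \<in> M"
  using assms(2,3)
proof (induction X rule: finite_induct)
  case empty
  then show ?case using submodule_zero[OF assms(1)] by simp
next
  case (insert v X)
  then show ?case
    using assms(1) submodule_carrier[OF assms(1)]
    by (subst lin_comb_insert) (auto intro!: submodule_add submodule_scale)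
qed

lemma module_span_minimal: "submodule s n M \<Longrightarrow> B \<subseteq> M \<Longrightarrow> module_span s n B \<subseteq> M"
  unfolding module_span_def by (auto intro!: submodule_lin_comb)

lemma module_span_mono: "B \<subseteq> C \<Longrightarrow> module_span s n B \<subseteq> module_span s n C"
  unfolding module_span_def by blast

lemma module_span_superset:
  assumes "B \<subseteq> carrier_vec n"
  shows "B \<subseteq> module_span s n B"
proof
  fix v assume "v \<in> B"
  then have "v = lin_comb s n (\<lambda>_. 1) {v}"
    using assms by (subst lin_comb_insert) (auto intro!: eq_vecI)
  then show "v \<in> module_span s n B"
    using \<open>v \<in> B\<close> unfolding module_span_def by blast
qed

lemma module_span_submodule:
  assumes "B \<subseteq> carrier_vec n"
  shows "submodule s n (module_span s n B)"
  unfolding submodule_def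
proof (intro conjI ballI allI)
  show "module_span s n B \<subseteq> carrier_vec n"
    using assms unfolding module_span_def by (auto intro!: lin_comb_carrier)
  show "0\<^sub>v n \<in> module_span s n B"
    unfolding module_span_def by (auto intro!: exI[of _ "{}"])
next
  fix x y assume "x \<in> module_span s n B" "y \<in> module_span s n B"
  then obtain X c Y d where x: "x = lin_comb s n c X" "finite X" "X \<subseteq> B"
    and y: "y = lin_comb s n d Y" "finite Y" "Y \<subseteq> B"
    unfolding module_span_def by blast
  have XY: "finite (X \<union> Y)" "X \<union> Y \<subseteq> carrier_vec n" using x y assms by auto
  have "x = lin_comb s n (\<lambda>v. if v \<in> X then c v else 0) (X \<union> Y)"
    unfolding x(1) by (rule lin_comb_cong_neutral[symmetric]) (use XY in auto)
  moreover have "y = lin_comb s n (\<lambda>v. if v \<in> Y then d v else 0) (X \<union> Y)"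
    unfolding y(1) by (rule lin_comb_cong_neutral[symmetric]) (use XY in auto)
  ultimately show "x + y \<in> module_span s n B"
    using XY x y unfolding module_span_def by (auto simp: lin_comb_add)
next
  fix a x assume "x \<in> module_span s n B"
  then show "side_scale s a x \<in> module_span s n B"
    using assms unfolding module_span_def by (fastforce simp: lin_comb_scale)
qed

lemma module_basis_submodule: "module_basis s n M B \<Longrightarrow> submodule s n M"
  unfolding module_basis_def using module_span_submodule by blast

lemma module_basis_subset: "module_basis s n M B \<Longrightarrow> B \<subseteq> M"
  unfolding module_basis_def using module_span_superset by blast

lemma module_basis_independent:
  "module_basis s n M B \<Longrightarrow> finite X \<Longrightarrow> X \<subseteq> B \<Longrightarrow> lin_comb s n c X = 0\<^sub>v n \<Longrightarrow> v \<in> X \<Longrightarrow> c v = 0"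
  unfolding module_basis_def module_independent_def by blast

lemma module_basis_coords:
  assumes B: "module_basis s n M B" "finite B" and "x \<in> M"
  obtains c where "x = lin_comb s n c B"
proof -
  obtain c X where x: "x = lin_comb s n c X" "finite X" "X \<subseteq> B"
    using B(1) \<open>x \<in> M\<close> unfolding module_basis_def module_span_def by blast
  have "lin_comb s n (\<lambda>v. if v \<in> X then c v else 0) B = lin_comb s n c X"
    using B x by (intro lin_comb_cong_neutral) (auto simp: module_basis_def)
  then show ?thesis using that x by metis
qed

lemma module_basis_coord_functions:
  assumes B: "module_basis s n M B" "finite B"
  obtains cf where
    "\<forall>x\<in>M. x = lin_comb s n (cf x) B"
    "\<forall>x\<in>M. \<forall>y\<in>M. \<forall>v\<in>B. cf (x + y) v = cf x v + cf y v"
    "\<forall>a. \<forall>x\<in>M. \<forall>v\<in>B. cf (side_scale s a x) v = side_mult s a (cf x v)"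
    "\<forall>v\<in>B. \<forall>w\<in>B. cf w v = (if v = w then 1 else 0)"
proof -
  have Bc: "B \<subseteq> carrier_vec n" using B by (simp add: module_basis_def)
  have M: "submodule s n M" by (rule module_basis_submodule[OF B(1)])
  define cf where "cf x = (SOME c. x = lin_comb s n c B)" for x
  have cf: "x = lin_comb s n (cf x) B" if "x \<in> M" for x
  proof -
    have "\<exists>c. x = lin_comb s n c B" using module_basis_coords[OF B that] by metis
    then show ?thesis unfolding cf_def by (rule someI_ex)
  qed
  have unique: "c v = d v" if "lin_comb s n c B = lin_comb s n d B" "v \<in> B" for c d v
  proof -
    have "lin_comb s n (\<lambda>v. c v + side_mult s (-1) (d v)) B = 0\<^sub>v n"
      using that(1) B(2) Bc
      by (subst lin_comb_add[symmetric], simp, simp, subst lin_comb_scale[symmetric], simp, simp)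
         (auto intro!: eq_vecI)
    then have "c v + side_mult s (-1) (d v) = 0"
      by (rule module_basis_independent[OF B(1,2) subset_refl _ that(2)])
    then show ?thesis by simp
  qed
  show ?thesis
  proof (rule that; intro ballI allI)
    fix x assume "x \<in> M"
    then show "x = lin_comb s n (cf x) B" by (rule cf)
  next
    fix x y v assume "x \<in> M" "y \<in> M" "v \<in> B"
    have "lin_comb s n (cf (x + y)) B = lin_comb s n (\<lambda>v. cf x v + cf y v) B"
      using cf[OF \<open>x \<in> M\<close>] cf[OF \<open>y \<in> M\<close>] cf[OF submodule_add[OF M \<open>x \<in> M\<close> \<open>y \<in> M\<close>]]
      by (simp add: lin_comb_add B(2) Bc flip: lin_comb_add)
    then show "cf (x + y) v = cf x v + cf y v" using unique \<open>v \<in> B\<close> by blast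
  next
    fix a x v assume "x \<in> M" "v \<in> B"
    have "lin_comb s n (cf (side_scale s a x)) B = lin_comb s n (\<lambda>v. side_mult s a (cf x v)) B"
      using cf[OF \<open>x \<in> M\<close>] cf[OF submodule_scale[OF M \<open>x \<in> M\<close>, of a]]
      by (simp add: B(2) Bc flip: lin_comb_scale)
    then show "cf (side_scale s a x) v = side_mult s a (cf x v)" using unique \<open>v \<in> B\<close> by blast
  next
    fix v w assume "v \<in> B" "w \<in> B"
    have "lin_comb s n (\<lambda>v. if v = w then 1 else 0) B = lin_comb s n (\<lambda>_. 1) {w}"
      using B Bc \<open>w \<in> B\<close> by (intro lin_comb_cong_neutral) auto
    also have "\<dots> = w"
      using Bc \<open>w \<in> B\<close> by (subst lin_comb_insert) (auto intro!: eq_vecI)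
    also have "\<dots> = lin_comb s n (cf w) B"
      using cf[of w] module_basis_subset[OF B(1)] \<open>w \<in> B\<close> by auto
    finally show "cf w v = (if v = w then 1 else 0)" using unique \<open>v \<in> B\<close> by fastforce
  qed
qed

section \<open>Submodules of $A^n$ are free\<close>

definition right_functional :: "'a::ring_1 Matrix.vec set \<Rightarrow> ('a Matrix.vec \<Rightarrow> 'a) \<Rightarrow> bool" where
  "right_functional N u \<longleftrightarrow> (\<forall>x\<in>N. \<forall>y\<in>N. u (x + y) = u x + u y) \<and>
     (\<forall>x\<in>N. \<forall>a. u (side_scale RightSide a x) = u x * a)"

lemma right_functional_zero:
  assumes "submodule RightSide n N" "right_functional N u"
  shows "u (0\<^sub>v n) = 0"
proof -
  have "u (0\<^sub>v n + 0\<^sub>v n) = u (0\<^sub>v n) + u (0\<^sub>v n)"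
    using assms submodule_zero[OF assms(1)] unfolding right_functional_def by blast
  then show ?thesis by simp
qed

lemma right_functional_lin_comb:
  assumes N: "submodule RightSide n N" and u: "right_functional N u" and X: "finite X" "X \<subseteq> N"
  shows "u (lin_comb RightSide n c X) = (\<Sum>v\<in>X. u v * c v)"
  using X
proof (induction X rule: finite_induct)
  case empty
  then show ?case using right_functional_zero[OF N u] by simp
next
  case (insert v X)
  have "lin_comb RightSide n c X \<in> N" "side_scale RightSide (c v) v \<in> N"
    using insert N by (auto intro!: submodule_lin_comb submodule_scale simp del: side_scale.simps)
  then have "u (side_scale RightSide (c v) v + lin_comb RightSide n c X) =
      u v * c v + u (lin_comb RightSide n c X)"
    using u insert unfolding right_functional_def by (auto simp del: side_scale.simps)
  then show ?case
    using insert submodule_carrier[OF N] by (subst lin_comb_insert) auto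
qed

lemma kernel_submodule:
  assumes N: "submodule RightSide n N" and u: "right_functional N u"
  shows "submodule RightSide n {x \<in> N. u x = 0}"
  using N u right_functional_zero[OF N u]
  unfolding submodule_def right_functional_def by (auto simp del: side_scale.simps)

lemma image_right_ideal:
  assumes N: "submodule RightSide n N" and u: "right_functional N u"
  shows "right_ideal (u ` N)"
  unfolding right_ideal_def
proof (intro conjI ballI allI)
  show "0 \<in> u ` N"
    using right_functional_zero[OF N u] submodule_zero[OF N] by (metis imageI)
next
  fix x y assume "x \<in> u ` N" "y \<in> u ` N"
  then obtain x' y' where "x' \<in> N" "y' \<in> N" "x = u x'" "y = u y'" by blast
  then have "x + y = u (x' + y')" "x' + y' \<in> N"
    using u N by (auto simp: right_functional_def submodule_add)
  then show "x + y \<in> u ` N" by blast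
next
  fix x a assume "x \<in> u ` N"
  then obtain x' where "x' \<in> N" "x = u x'" by blast
  then have "x * a = u (side_scale RightSide a x')" "side_scale RightSide a x' \<in> N"
    using u submodule_scale[OF N] by (auto simp: right_functional_def simp del: side_scale.simps)
  then show "x * a \<in> u ` N" by blast
qed

text \<open>
  As the image of the functional is free, the functional splits, and \<open>N\<close> is the direct sum of the kernel and a
  copy of the image.  A basis of the kernel and lifted basis elements of the image together form a
  basis of \<open>N\<close>.
\<close>
lemma kernel_basis_extends:
  assumes N: "submodule RightSide n N" and u: "right_functional N u"
    and E: "right_ideal_basis (u ` N) E"
    and BZ: "module_basis RightSide n {x \<in> N. u x = 0} BZ"
  shows "\<exists>C. module_basis RightSide n N C \<and> BZ \<subseteq> C"
proof -
  define lift where "lift = inv_into N u"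
  have E_sub: "E \<subseteq> u ` N"
    and E_rel: "\<forall>X c. finite X \<and> X \<subseteq> E \<and> (\<Sum>v\<in>X. v * c v) = 0 \<longrightarrow> (\<forall>v\<in>X. c v = 0)"
    and E_span: "\<forall>J. right_ideal J \<and> E \<subseteq> J \<longrightarrow> u ` N \<subseteq> J"
    by (rule conjunct1[OF E[unfolded right_ideal_basis_def]]
          conjunct1[OF conjunct2[OF E[unfolded right_ideal_basis_def]]]
          conjunct2[OF conjunct2[OF E[unfolded right_ideal_basis_def]]])+
  have lift: "lift e \<in> N" "u (lift e) = e" if "e \<in> E" for e
    using that E_sub unfolding lift_def by (auto intro: inv_into_into f_inv_into_f)
  have BZ_ker: "b \<in> N" "u b = 0" if "b \<in> BZ" for b
    using module_basis_subset[OF BZ] that by auto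
  define C where "C = BZ \<union> lift ` E"
  have CN: "C \<subseteq> N" using lift BZ_ker by (auto simp: C_def)
  have Cc: "C \<subseteq> carrier_vec n" using CN submodule_carrier[OF N] by blast
  have "module_independent RightSide n C"
    unfolding module_independent_def
  proof (intro allI impI)
    fix X c
    assume X: "finite X \<and> X \<subseteq> C \<and> lin_comb RightSide n c X = 0\<^sub>v n"
    define X1 where "X1 = X - BZ"
    have X1: "finite X1" "X1 \<subseteq> lift ` E" using X by (auto simp: X1_def C_def)
    have lift_u: "lift (u v) = v" if "v \<in> X1" for v using that X1(2) lift(2) by auto
    have u_E: "u v \<in> E" if "v \<in> X1" for v using that X1(2) lift(2) by auto
    have inj: "inj_on u X1" using lift_u by (rule inj_on_inverseI)
    have "(\<Sum>v\<in>X. u v * c v) = u (lin_comb RightSide n c X)"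
      using right_functional_lin_comb[OF N u, of X c] X CN by auto
    also have "\<dots> = 0" using X right_functional_zero[OF N u] by simp
    finally have "(\<Sum>v\<in>X. u v * c v) = 0" .
    moreover have "(\<Sum>v\<in>X. u v * c v) = (\<Sum>v\<in>X1. u v * c v)"
      using X BZ_ker by (intro sum.mono_neutral_right) (auto simp: X1_def)
    moreover have "\<dots> = (\<Sum>v\<in>X1. u v * c (lift (u v)))"
      using lift_u by (intro sum.cong) auto
    moreover have "\<dots> = (\<Sum>e\<in>u ` X1. e * c (lift e))"
      using inj by (simp add: sum.reindex)
    ultimately have "(\<Sum>e\<in>u ` X1. e * c (lift e)) = 0" by simp
    then have c1: "c (lift e) = 0" if "e \<in> u ` X1" for e
      using E_rel[rule_format, of "u ` X1" "\<lambda>e. c (lift e)" e] that X1(1) u_E by blast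
    have X1_0: "c v = 0" if "v \<in> X1" for v
      using c1[of "u v"] that lift_u by auto
    have "lin_comb RightSide n c X = lin_comb RightSide n c (X \<inter> BZ)"
      using X Cc X1_0 by (intro lin_comb_cong_neutral) (auto simp: X1_def)
    then have "c v = 0" if "v \<in> X \<inter> BZ" for v
      using module_basis_independent[OF BZ, of "X \<inter> BZ" c v] X that by simp
    then show "\<forall>v\<in>X. c v = 0" using X1_0 by (auto simp: X1_def)
  qed
  moreover have "module_span RightSide n C = N"
  proof
    show "module_span RightSide n C \<subseteq> N" by (rule module_span_minimal[OF N CN])
    have span: "submodule RightSide n (module_span RightSide n C)"
      by (rule module_span_submodule[OF Cc])
    have sup: "C \<subseteq> module_span RightSide n C" by (rule module_span_superset[OF Cc])
    have spanN: "module_span RightSide n C \<subseteq> N" by (rule module_span_minimal[OF N CN])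
    have "right_functional (module_span RightSide n C) u"
      using u spanN unfolding right_functional_def by blast
    then have "right_ideal (u ` module_span RightSide n C)"
      by (rule image_right_ideal[OF span])
    moreover have "E \<subseteq> u ` module_span RightSide n C"
    proof
      fix e assume "e \<in> E"
      then have "lift e \<in> module_span RightSide n C" using sup by (auto simp: C_def)
      then show "e \<in> u ` module_span RightSide n C" using lift(2)[OF \<open>e \<in> E\<close>] by (metis imageI)
    qed
    ultimately have img: "u ` N \<subseteq> u ` module_span RightSide n C" using E_span by blast
    show "N \<subseteq> module_span RightSide n C"
    proof
      fix x assume "x \<in> N"
      then obtain y where y: "y \<in> module_span RightSide n C" "u x = u y" using img by blast
      have yN: "y \<in> N" using y spanN by blast
      have carr: "x \<in> carrier_vec n" "y \<in> carrier_vec n"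
        using \<open>x \<in> N\<close> yN submodule_carrier[OF N] by auto
      have xy: "x - y \<in> N" using submodule_diff[OF N \<open>x \<in> N\<close> yN] .
      have "x = (x - y) + y" using carr by (auto intro!: eq_vecI)
      then have "u x = u (x - y) + u y"
        using u xy yN unfolding right_functional_def by metis
      then have "x - y \<in> {x \<in> N. u x = 0}" using y xy by simp
      also have "\<dots> = module_span RightSide n BZ" using BZ by (simp add: module_basis_def)
      also have "\<dots> \<subseteq> module_span RightSide n C" by (rule module_span_mono) (simp add: C_def)
      finally have "(x - y) + y \<in> module_span RightSide n C" using y by (intro submodule_add[OF span])
      then show "x \<in> module_span RightSide n C" using \<open>x = (x - y) + y\<close> by simp
    qed
  qed
  ultimately have "module_basis RightSide n N C"
    using Cc by (simp add: module_basis_def)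
  then show ?thesis by (auto simp: C_def)
qed

text \<open>
  Split off the coordinates one at a time: the last coordinate maps \<open>N\<close> onto a right ideal, which is
  free, and its kernel has one coordinate fewer.
\<close>
theorem submodule_free:
  fixes S :: "'f::group_add set" and N :: "('f \<Rightarrow>\<^sub>0 'k::field) Matrix.vec set"
  assumes basis: "free_group_basis S" and N: "submodule RightSide n N"
  shows "\<exists>B. module_basis RightSide n N B"
proof -
  have "\<exists>B. module_basis RightSide n N B"
    if "submodule RightSide n N" "\<And>x i. x \<in> N \<Longrightarrow> j \<le> i \<Longrightarrow> i < n \<Longrightarrow> x $ i = 0" for j
    and N :: "('f \<Rightarrow>\<^sub>0 'k) Matrix.vec set"
    using that
  proof (induction j arbitrary: N)
    case 0
    have "x = 0\<^sub>v n" if "x \<in> N" for x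
    proof -
      have "x \<in> carrier_vec n" using that submodule_carrier[OF 0(1)] by blast
      then show ?thesis using 0(2)[OF that] by (intro eq_vecI) simp_all
    qed
    then have "N = {0\<^sub>v n}" using submodule_zero[OF 0(1)] by blast
    then have "module_basis RightSide n N {}"
      unfolding module_basis_def module_independent_def module_span_def by auto
    then show ?case by blast
  next
    case (Suc j)
    show ?case
    proof (cases "j < n")
      case False
      then show ?thesis using Suc by (intro Suc.IH) auto
    next
      case True
      define u where "u x = x $ j" for x :: "('f \<Rightarrow>\<^sub>0 'k) Matrix.vec"
      have u: "right_functional N u"
        using True submodule_carrier[OF Suc.prems(1)]
        unfolding right_functional_def u_def by (auto simp: subset_iff)
      obtain E where E: "right_ideal_basis (u ` N) E"
        using right_ideal_free[OF basis image_right_ideal[OF Suc.prems(1) u]] by blast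
      have "\<exists>B. module_basis RightSide n {x \<in> N. u x = 0} B"
      proof (rule Suc.IH)
        show "submodule RightSide n {x \<in> N. u x = 0}"
          by (rule kernel_submodule[OF Suc.prems(1) u])
        fix x i assume "x \<in> {x \<in> N. u x = 0}" "j \<le> i" "i < n"
        then show "x $ i = 0" using Suc.prems(2)[of x i] by (cases "i = j") (auto simp: u_def)
      qed
      then show ?thesis using kernel_basis_extends[OF Suc.prems(1) u E] by blast
    qed
  qed
  from this[of N n] show ?thesis using N by simp
qed

section \<open>Matrices over bases and row modules\<close>

lemma nth_carrier_vec: "set ws \<subseteq> carrier_vec n \<Longrightarrow> i < length ws \<Longrightarrow> ws ! i \<in> carrier_vec n"
  by (rule subsetD[OF _ nth_mem])

text \<open>
  Sums over index sets, for families of vectors with possible repetitions; \<^const>\<open>lin_comb\<close> sums over sets.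
\<close>
abbreviation vsum :: "nat \<Rightarrow> ('i \<Rightarrow> 'a::ring_1 Matrix.vec) \<Rightarrow> 'i set \<Rightarrow> 'a Matrix.vec" where
  "vsum n f I \<equiv> finsum_vec TYPE('a) n f I"

lemma vsum_carrier: "f \<in> I \<rightarrow> carrier_vec n \<Longrightarrow> vsum n f I \<in> carrier_vec n"
  by (rule finsum_vec_closed)

lemma vsum_cong:
  "(\<And>i. i \<in> I \<Longrightarrow> f i = g i) \<Longrightarrow> g \<in> I \<rightarrow> carrier_vec n \<Longrightarrow> vsum n f I = vsum n g I"
  by (rule comm_monoid.finprod_cong'[OF comm_monoid_vec, folded finsum_vec_def, unfolded monoid_vec_simps])
     auto

lemma submodule_vsum:
  assumes M: "submodule s n M" and "finite I" "f \<in> I \<rightarrow> M"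
  shows "vsum n f I \<in> M"
  using assms(2,3)
proof (induction I rule: finite_induct)
  case empty
  then show ?case using submodule_zero[OF M] by (simp add: finsum_vec_empty)
next
  case (insert i I)
  then have "vsum n f (insert i I) = f i + vsum n f I"
    using submodule_carrier[OF M] by (intro finsum_vec_insert) auto
  then show ?case using insert by (auto intro!: submodule_add[OF M])
qed

lemma lin_comb_distinct_list:
  assumes "distinct ws" "set ws \<subseteq> carrier_vec n"
  shows "lin_comb s n c (set ws) = vsum n (\<lambda>i. side_scale s (c (ws ! i)) (ws ! i)) {..<length ws}"
proof (rule eq_vecI)
  have f: "(\<lambda>i. side_scale s (c (ws ! i)) (ws ! i)) \<in> {..<length ws} \<rightarrow> carrier_vec n"
    using nth_carrier_vec[OF assms(2)] by simp
  show "dim_vec (lin_comb s n c (set ws)) =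
      dim_vec (vsum n (\<lambda>i. side_scale s (c (ws ! i)) (ws ! i)) {..<length ws})"
    using carrier_vecD[OF vsum_carrier[OF f]] assms by simp
  fix r assume "r < dim_vec (vsum n (\<lambda>i. side_scale s (c (ws ! i)) (ws ! i)) {..<length ws})"
  then have r: "r < n" using carrier_vecD[OF vsum_carrier[OF f]] by simp
  have "lin_comb s n c (set ws) $ r = (\<Sum>v\<in>set ws. side_mult s (c v) (v $ r))"
    using assms r by (simp add: lin_comb_index)
  also have "\<dots> = (\<Sum>i<length ws. side_mult s (c (ws ! i)) (ws ! i $ r))"
    using bij_betw_nth[OF assms(1) refl refl] by (rule sum.reindex_bij_betw[symmetric])
  also have "\<dots> = (\<Sum>i<length ws. side_scale s (c (ws ! i)) (ws ! i) $ r)"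
    using carrier_vecD[OF nth_carrier_vec[OF assms(2)]] r by (intro sum.cong) simp_all
  also have "\<dots> = vsum n (\<lambda>i. side_scale s (c (ws ! i)) (ws ! i)) {..<length ws} $ r"
    using f r by (intro index_finsum_vec[symmetric]) auto
  finally show "lin_comb s n c (set ws) $ r = \<dots>" .
qed

lemma distinct_list_coefficients:
  assumes "distinct ws"
  obtains c where "\<forall>i<length ws. c (ws ! i) = a i"
proof (rule that, intro allI impI)
  fix i assume "i < length ws"
  then show "(\<lambda>v. a (inv_into {..<length ws} ((!) ws) v)) (ws ! i) = a i"
    using inj_on_nth[OF assms, of "{..<length ws}"] by (simp add: inv_into_f_f)
qed

lemma module_basis_list_unique:
  assumes ws: "distinct ws" "module_basis s n M (set ws)"
    and eq: "vsum n (\<lambda>i. side_scale s (a i) (ws ! i)) {..<length ws} =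
       vsum n (\<lambda>i. side_scale s (b i) (ws ! i)) {..<length ws}"
    and i: "i < length ws"
  shows "a i = b i"
proof -
  obtain cf where "\<forall>x\<in>M. x = lin_comb s n (cf x) (set ws)"
    and coords: "\<forall>x\<in>M. \<forall>y\<in>M. \<forall>v\<in>set ws. cf (x + y) v = cf x v + cf y v"
      "\<forall>a. \<forall>x\<in>M. \<forall>v\<in>set ws. cf (side_scale s a x) v = side_mult s a (cf x v)"
      "\<forall>v\<in>set ws. \<forall>w\<in>set ws. cf w v = (if v = w then 1 else 0)"
    by (rule module_basis_coord_functions[OF ws(2) List.finite_set])
  note cf = coords[rule_format]
  have M: "submodule s n M" by (rule module_basis_submodule[OF ws(2)])
  have wsM: "set ws \<subseteq> M" by (rule module_basis_subset[OF ws(2)])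
  define v where "v = ws ! i"
  have v: "v \<in> set ws" using i by (simp add: v_def)
  have zero: "cf (0\<^sub>v n) v = 0"
  proof -
    have "cf (0\<^sub>v n + 0\<^sub>v n) v = cf (0\<^sub>v n) v + cf (0\<^sub>v n) v"
      using cf(1) submodule_zero[OF M] v by blast
    then show ?thesis by simp
  qed
  have sum: "cf (vsum n (\<lambda>i. side_scale s (a i) (ws ! i)) I) v =
      (\<Sum>j\<in>I. side_mult s (a j) (cf (ws ! j) v))" if "finite I" "I \<subseteq> {..<length ws}" for a I
    using that
  proof (induction I rule: finite_induct)
    case empty
    then show ?case by (simp add: finsum_vec_empty zero)
  next
    case (insert j I)
    have w: "ws ! l \<in> M" if "l \<in> insert j I" for l
      using that insert.prems wsM by (auto simp: subset_iff)
    have sc: "(\<lambda>i. side_scale s (a i) (ws ! i)) \<in> insert j I \<rightarrow> M"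
      using w submodule_scale[OF M] by blast
    have "vsum n (\<lambda>i. side_scale s (a i) (ws ! i)) (insert j I) =
        side_scale s (a j) (ws ! j) + vsum n (\<lambda>i. side_scale s (a i) (ws ! i)) I"
      using insert.hyps sc submodule_carrier[OF M] by (intro finsum_vec_insert) auto
    moreover have "vsum n (\<lambda>i. side_scale s (a i) (ws ! i)) I \<in> M"
      using sc insert.hyps by (intro submodule_vsum[OF M]) auto
    ultimately show ?case
      using insert w v by (simp add: cf(1,2) submodule_scale[OF M])
  qed
  have coord: "cf (vsum n (\<lambda>i. side_scale s (a i) (ws ! i)) {..<length ws}) v = a i" for a
  proof -
    have "(\<Sum>j<length ws. side_mult s (a j) (cf (ws ! j) v)) = (\<Sum>j<length ws. if j = i then a j else 0)"
      using i ws(1) v by (intro sum.cong) (auto simp: cf(3) v_def nth_eq_iff_index_eq)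
    then show ?thesis using i by (simp add: sum)
  qed
  show ?thesis using coord[of a] coord[of b] eq by simp
qed

text \<open>
  For lists, independence excludes repetitions: if two entries were equal, their difference would be a relation.
\<close>
lemma module_basis_listI:
  assumes ws: "set ws \<subseteq> carrier_vec n"
    and indep: "\<And>u i. vsum n (\<lambda>i. side_scale s (u i) (ws ! i)) {..<length ws} = 0\<^sub>v n
      \<Longrightarrow> i < length ws \<Longrightarrow> u i = 0"
  shows "distinct ws \<and> module_basis s n (module_span s n (set ws)) (set ws)"
proof
  show dist: "distinct ws"
    unfolding distinct_conv_nth
  proof (intro allI impI notI)
    fix i j assume ij: "i < length ws" "j < length ws" "i \<noteq> j" "ws ! i = ws ! j"
    define u where "u l = (if l = i then 1 else if l = j then - 1 else 0 :: 'a)" for l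
    have f: "(\<lambda>l. side_scale s (u l) (ws ! l)) \<in> {..<length ws} \<rightarrow> carrier_vec n"
      using nth_carrier_vec[OF ws] by simp
    have "vsum n (\<lambda>l. side_scale s (u l) (ws ! l)) {..<length ws} = 0\<^sub>v n"
    proof (rule eq_vecI)
      fix r assume r: "r < dim_vec (0\<^sub>v n :: 'a Matrix.vec)"
      have "vsum n (\<lambda>l. side_scale s (u l) (ws ! l)) {..<length ws} $ r =
          (\<Sum>l<length ws. side_scale s (u l) (ws ! l) $ r)"
        using f r by (intro index_finsum_vec) auto
      also have "\<dots> = (\<Sum>l<length ws. (if l = i then ws ! l $ r else 0) + (if l = j then - (ws ! l $ r) else 0))"
        using carrier_vecD[OF nth_carrier_vec[OF ws]] r ij by (intro sum.cong) (simp_all add: u_def)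
      also have "\<dots> = 0" using ij by (simp add: sum.distrib)
      finally show "vsum n (\<lambda>l. side_scale s (u l) (ws ! l)) {..<length ws} $ r = 0\<^sub>v n $ r"
        using r by simp
    qed (use carrier_vecD[OF vsum_carrier[OF f]] in simp)
    then have "u i = 0" using indep ij by blast
    then show False by (simp add: u_def)
  qed
  have "module_independent s n (set ws)"
    unfolding module_independent_def
  proof (intro allI impI ballI)
    fix X c v
    assume X: "finite X \<and> X \<subseteq> set ws \<and> lin_comb s n c X = 0\<^sub>v n" and v: "v \<in> X"
    define d where "d v = (if v \<in> X then c v else 0)" for v
    have "lin_comb s n d (set ws) = lin_comb s n c X"
      using X ws by (intro lin_comb_cong_neutral) (auto simp: d_def)
    then have "vsum n (\<lambda>i. side_scale s (d (ws ! i)) (ws ! i)) {..<length ws} = 0\<^sub>v n"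
      using X lin_comb_distinct_list[OF dist ws] by simp
    then have d0: "d (ws ! i) = 0" if "i < length ws" for i
      using that by (rule indep)
    obtain i where "i < length ws" "ws ! i = v" using X v by (metis in_set_conv_nth subset_iff)
    then show "c v = 0" using d0[of i] v by (simp add: d_def)
  qed
  then show "module_basis s n (module_span s n (set ws)) (set ws)"
    using ws by (simp add: module_basis_def)
qed

lemma col_mult_conv_vsum:
  assumes gs: "set gs \<subseteq> carrier_vec k" and P: "P \<in> carrier_mat (length gs) l" and j: "j < l"
  shows "col (mat_of_cols k gs * P) j = vsum k (\<lambda>a. side_scale RightSide (P $$ (a, j)) (gs ! a)) {..<length gs}"
proof (rule eq_vecI)
  have f: "(\<lambda>a. side_scale RightSide (P $$ (a, j)) (gs ! a)) \<in> {..<length gs} \<rightarrow> carrier_vec k"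
    using nth_carrier_vec[OF gs] by (simp del: side_scale.simps)
  note d = carrier_vecD[OF vsum_carrier[OF f]]
  show "dim_vec (col (mat_of_cols k gs * P) j) =
      dim_vec (vsum k (\<lambda>a. side_scale RightSide (P $$ (a, j)) (gs ! a)) {..<length gs})"
    using d by simp
  fix r assume "r < dim_vec (vsum k (\<lambda>a. side_scale RightSide (P $$ (a, j)) (gs ! a)) {..<length gs})"
  then have r: "r < k" using d by simp
  have "col (mat_of_cols k gs * P) j $ r = (\<Sum>a<length gs. gs ! a $ r * P $$ (a, j))"
    using P j r by (simp add: scalar_prod_def mat_of_cols_index atLeast0LessThan)
  also have "\<dots> = (\<Sum>a<length gs. side_scale RightSide (P $$ (a, j)) (gs ! a) $ r)"
    using carrier_vecD[OF nth_carrier_vec[OF gs]] r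
    by (intro sum.cong) (simp_all add: side_mult_def del: side_scale.simps)
  also have "\<dots> = vsum k (\<lambda>a. side_scale RightSide (P $$ (a, j)) (gs ! a)) {..<length gs} $ r"
    using f r by (intro index_finsum_vec[symmetric]) auto
  finally show "col (mat_of_cols k gs * P) j $ r = \<dots>" .
qed

lemma row_mult_conv_vsum:
  assumes P: "P \<in> carrier_mat t l" and B: "B \<in> carrier_mat l m" and i: "i < t"
  shows "row (P * B) i = vsum m (\<lambda>a. side_scale LeftSide (P $$ (i, a)) (row B a)) {..<l}"
proof (rule eq_vecI)
  have f: "(\<lambda>a. side_scale LeftSide (P $$ (i, a)) (row B a)) \<in> {..<l} \<rightarrow> carrier_vec m"
    using B by auto
  note d = carrier_vecD[OF vsum_carrier[OF f]]
  show "dim_vec (row (P * B) i) =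
      dim_vec (vsum m (\<lambda>a. side_scale LeftSide (P $$ (i, a)) (row B a)) {..<l})"
    using d B by simp
  fix r assume "r < dim_vec (vsum m (\<lambda>a. side_scale LeftSide (P $$ (i, a)) (row B a)) {..<l})"
  then have r: "r < m" using d by simp
  have "row (P * B) i $ r = (\<Sum>a<l. P $$ (i, a) * B $$ (a, r))"
    using P B i r by (simp add: scalar_prod_def atLeast0LessThan)
  also have "\<dots> = (\<Sum>a<l. side_scale LeftSide (P $$ (i, a)) (row B a) $ r)"
    using B r by (intro sum.cong) auto
  also have "\<dots> = vsum m (\<lambda>a. side_scale LeftSide (P $$ (i, a)) (row B a)) {..<l} $ r"
    using f r by (intro index_finsum_vec[symmetric]) auto
  finally show "row (P * B) i $ r = \<dots>" .
qed

lemma row_module_mult_subset: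
  assumes P: "P \<in> carrier_mat t l" and B: "B \<in> carrier_mat l m"
  shows "row_module (P * B) \<subseteq> row_module B"
proof -
  have rows: "set (rows B) \<subseteq> carrier_vec m" using B rows_carrier[of B] by simp
  have sub: "submodule LeftSide m (row_module B)"
    using B module_span_submodule[OF rows] by (simp add: row_module_def)
  have "row B a \<in> row_module B" if "a < l" for a
    using module_span_superset[OF rows, of LeftSide] B that by (auto simp: row_module_def rows_def)
  then have row_in: "row (P * B) i \<in> row_module B" if "i < t" for i
    unfolding row_mult_conv_vsum[OF P B that]
    by (intro submodule_vsum[OF sub]) (auto intro!: submodule_scale[OF sub] simp del: side_scale.simps)
  have "set (rows (P * B)) \<subseteq> row_module B"
  proof
    fix v assume "v \<in> set (rows (P * B))"
    then obtain i where "i < t" "v = row (P * B) i" using P by (auto simp: rows_def)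
    then show "v \<in> row_module B" using row_in by simp
  qed
  then show ?thesis
    unfolding row_module_def[of "P * B"] using module_span_minimal[OF sub] B by simp
qed

lemma basis_matrix_exists:
  assumes gs: "distinct gs" "module_basis RightSide k M (set gs)" and fs: "set fs \<subseteq> M"
  obtains P where "P \<in> carrier_mat (length gs) (length fs)" "mat_of_cols k fs = mat_of_cols k gs * P"
proof -
  have gsc: "set gs \<subseteq> carrier_vec k" using gs by (simp add: module_basis_def)
  have fsc: "set fs \<subseteq> carrier_vec k" using fs submodule_carrier[OF module_basis_submodule[OF gs(2)]] by blast
  have "\<exists>c. f = lin_comb RightSide k c (set gs)" if "f \<in> M" for f
    using module_basis_coords[OF gs(2) _ that] by blast
  then obtain c where c: "\<And>f. f \<in> M \<Longrightarrow> f = lin_comb RightSide k (c f) (set gs)" by metis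
  define P where "P = mat (length gs) (length fs) (\<lambda>(a, j). c (fs ! j) (gs ! a))"
  have P: "P \<in> carrier_mat (length gs) (length fs)" by (simp add: P_def)
  have col_eq: "col (mat_of_cols k gs * P) j = fs ! j" if "j < length fs" for j
  proof -
    have "fs ! j = lin_comb RightSide k (c (fs ! j)) (set gs)"
      by (rule c) (use fs that in auto)
    also have "\<dots> = vsum k (\<lambda>a. side_scale RightSide (c (fs ! j) (gs ! a)) (gs ! a)) {..<length gs}"
      by (rule lin_comb_distinct_list[OF gs(1) gsc])
    also have "\<dots> = vsum k (\<lambda>a. side_scale RightSide (P $$ (a, j)) (gs ! a)) {..<length gs}"
      using that gsc by (intro vsum_cong) (auto simp: P_def intro: nth_carrier_vec)
    finally show ?thesis using col_mult_conv_vsum[OF gsc P that] by simp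
  qed
  have "mat_of_cols k fs = mat_of_cols k gs * P"
  proof (rule mat_col_eqI)
    fix j assume "j < dim_col (mat_of_cols k gs * P)"
    then have "j < length fs" using P by simp
    then show "col (mat_of_cols k fs) j = col (mat_of_cols k gs * P) j"
      using col_eq fsc by (auto simp: subset_iff)
  qed (use P in auto)
  then show ?thesis using that P by blast
qed

lemma basis_matrix_unique:
  assumes gs: "distinct gs" "module_basis RightSide k M (set gs)"
    and P: "P \<in> carrier_mat (length gs) l" and R: "R \<in> carrier_mat (length gs) l"
    and eq: "mat_of_cols k gs * P = mat_of_cols k gs * R"
  shows "P = R"
proof (rule eq_matI)
  have gsc: "set gs \<subseteq> carrier_vec k" using gs by (simp add: module_basis_def)
  fix i j assume "i < dim_row R" "j < dim_col R"
  then have ij: "i < length gs" "j < l" using R by auto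
  show "P $$ (i, j) = R $$ (i, j)"
    by (rule module_basis_list_unique[OF gs _ ij(1)])
       (use col_mult_conv_vsum[OF gsc P ij(2)] col_mult_conv_vsum[OF gsc R ij(2)] eq in simp)
qed (use P R in auto)

text \<open>
  Expressing \<open>fs\<close> through the basis \<open>gs\<close> gives \<open>P\<close>, and \<open>C = P * B\<close> holds because coordinates
  with respect to \<open>gs\<close> are unique.
\<close>
lemma change_of_basis:
  assumes gs: "distinct gs" "module_basis RightSide k M (set gs)" and fs: "set fs \<subseteq> M"
    and B: "B \<in> carrier_mat (length fs) m" and C: "C \<in> carrier_mat (length gs) m"
    and eq: "mat_of_cols k fs * B = mat_of_cols k gs * C"
  obtains P where "P \<in> carrier_mat (length gs) (length fs)" "mat_of_cols k fs = mat_of_cols k gs * P"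
    "C = P * B"
proof -
  obtain P where P: "P \<in> carrier_mat (length gs) (length fs)" "mat_of_cols k fs = mat_of_cols k gs * P"
    using basis_matrix_exists[OF gs fs] by blast
  have "mat_of_cols k gs * C = mat_of_cols k gs * (P * B)"
    using eq P B assoc_mult_mat[OF mat_of_cols_carrier(1) P(1) B] by simp
  then have "C = P * B" by (rule basis_matrix_unique[OF gs C mult_carrier_mat[OF P(1) B]])
  then show ?thesis using that P by blast
qed

section \<open>Algebraic extensions and their duals\<close>

lemma free_factor_subset: "free_factor s n M N \<Longrightarrow> M \<subseteq> N"
  unfolding free_factor_def module_basis_def using module_span_mono by blast

lemma free_factor_refl: "module_basis s n M B \<Longrightarrow> free_factor s n M M"
  unfolding free_factor_def by blast

lemma alg_extension_free_factor_eq: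
  "alg_extension s n R N \<Longrightarrow> free_factor s n M N \<Longrightarrow> R \<subseteq> M \<Longrightarrow> M = N"
  using free_factor_subset unfolding alg_extension_def by blast

text \<open>
  Finitely many elements of any basis suffice to express \<open>X\<close>.  They span a free factor containing the
  small module, which has to be everything.
\<close>
lemma alg_extension_finite_basis:
  assumes alg: "alg_extension s n (module_span s n X) N" and X: "finite X" "X \<subseteq> carrier_vec n"
  obtains B where "finite B" "module_basis s n N B"
proof -
  obtain C where C: "module_basis s n N C"
    using alg unfolding alg_extension_def free_submodule_def by blast
  have XN: "X \<subseteq> N"
    using alg module_span_superset[OF X(2), of s] unfolding alg_extension_def by blast
  have "\<exists>Y. finite Y \<and> Y \<subseteq> C \<and> x \<in> module_span s n Y" if "x \<in> N" for x
    using C that unfolding module_basis_def module_span_def by fast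
  then obtain Y where Y: "\<And>x. x \<in> N \<Longrightarrow> finite (Y x) \<and> Y x \<subseteq> C \<and> x \<in> module_span s n (Y x)"
    by metis
  define B where "B = \<Union>(Y ` X)"
  have B: "finite B" "B \<subseteq> C" using X XN Y by (auto simp: B_def)
  have Bc: "B \<subseteq> carrier_vec n" using B C by (auto simp: module_basis_def)
  have basis: "module_basis s n (module_span s n B) B"
    using B C Bc unfolding module_basis_def module_independent_def by blast
  have "X \<subseteq> module_span s n B"
  proof
    fix x assume "x \<in> X"
    then have "x \<in> module_span s n (Y x)" "Y x \<subseteq> B" using XN Y by (auto simp: B_def)
    then show "x \<in> module_span s n B" using module_span_mono by blast
  qed
  then have "module_span s n X \<subseteq> module_span s n B"
    by (rule module_span_minimal[OF module_span_submodule[OF Bc]])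
  moreover have "free_factor s n (module_span s n B) N"
    unfolding free_factor_def using basis C B by blast
  ultimately have "module_span s n B = N"
    using alg_extension_free_factor_eq[OF alg] by blast
  then show ?thesis using that B basis by blast
qed

text \<open>
  The only free factor of \<open>L\<close> that contains the column module is \<open>L\<close>, so the dual is computed from a
  basis of \<open>L\<close> itself; two such bases differ by mutually inverse changes of coordinates, which
  preserve the row module.
\<close>
lemma alg_extension_dual:
  assumes Q: "Q \<in> carrier_mat k m" and alg: "alg_extension RightSide k (column_module Q) L"
  obtains fs B where "distinct fs" "module_basis RightSide k L (set fs)"
    "B \<in> carrier_mat (length fs) m" "Q = mat_of_cols k fs * B" "Q_dual Q L = row_module B"
proof -
  have dims: "dim_row Q = k" "dim_col Q = m" using Q by auto
  have colsc: "set (cols Q) \<subseteq> carrier_vec k" using cols_dim[of Q] dims by simp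
  have RL: "column_module Q \<subseteq> L" using alg by (simp add: alg_extension_def)
  have colsL: "set (cols Q) \<subseteq> L"
    using module_span_superset[OF colsc, of RightSide] RL dims by (simp add: column_module_def)
  have "alg_extension RightSide k (module_span RightSide k (set (cols Q))) L"
    using alg dims by (simp add: column_module_def)
  then obtain F where F: "finite F" "module_basis RightSide k L F"
    by (rule alg_extension_finite_basis[OF _ List.finite_set colsc])
  obtain fs where "distinct fs" "set fs = F"
    using finite_distinct_list[OF F(1)] by blast
  then have fs: "distinct fs" "module_basis RightSide k L (set fs)"
    using F(2) by auto
  have "mat_of_cols k (cols Q) = Q" using mat_of_cols_cols[of Q] dims by simp
  then obtain B where B: "B \<in> carrier_mat (length fs) m" "Q = mat_of_cols k fs * B"
    using basis_matrix_exists[OF fs colsL] dims by (metis cols_length)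
  have dual: "is_Q_dual Q L (row_module B)"
    unfolding is_Q_dual_def dims using fs B RL free_factor_refl by blast
  have "D = row_module B" if dualD: "is_Q_dual Q L D" for D
  proof -
    obtain M gs C where M: "free_factor RightSide k M L" "column_module Q \<subseteq> M"
      and gs: "distinct gs" "module_basis RightSide k M (set gs)"
      and C: "C \<in> carrier_mat (length gs) m" "Q = mat_of_cols k gs * C"
      and D: "D = row_module C"
      using dualD unfolding is_Q_dual_def dims by blast
    have "M = L" by (rule alg_extension_free_factor_eq[OF alg M])
    then have gsL: "module_basis RightSide k L (set gs)" using gs by simp
    have eq: "mat_of_cols k fs * B = mat_of_cols k gs * C" using B C by simp
    obtain P where P: "P \<in> carrier_mat (length gs) (length fs)" "C = P * B"
      using change_of_basis[OF gs(1) gsL module_basis_subset[OF fs(2)] B(1) C(1) eq] by blast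
    obtain P' where P': "P' \<in> carrier_mat (length fs) (length gs)" "B = P' * C"
      using change_of_basis[OF fs module_basis_subset[OF gsL] C(1) B(1) eq[symmetric]] by blast
    have "row_module C \<subseteq> row_module B"
      using row_module_mult_subset[OF P(1) B(1)] by (simp flip: P(2))
    moreover have "row_module B \<subseteq> row_module C"
      using row_module_mult_subset[OF P'(1) C(1)] by (simp flip: P'(2))
    ultimately show ?thesis using D by blast
  qed
  then have "Q_dual Q L = row_module B"
    unfolding Q_dual_def by (rule the_equality[where P = "is_Q_dual Q L", OF dual])
  then show ?thesis using that fs B by blast
qed

text \<open>
  This is where algebraicity and the freeness of submodules meet.  A relation \<open>u\<close> between the rows of
  \<open>B\<close> defines a functional \<open>h\<close> on \<open>L\<close> with values \<open>u\<close> on the basis \<open>fs\<close>, and the relation says that \<open>h\<close>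
  kills the columns of \<open>Q\<close>.  Kernel and image of \<open>h\<close> are free, so the kernel is a free factor of \<open>L\<close>.
  By algebraicity it is all of \<open>L\<close>, whence \<open>u = 0\<close>.
\<close>
theorem dual_rows_independent:
  fixes S :: "'f::group_add set" and Q :: "('f \<Rightarrow>\<^sub>0 'k::field) mat"
  assumes basis: "free_group_basis S"
    and alg: "alg_extension RightSide k (column_module Q) L"
    and fs: "distinct fs" "module_basis RightSide k L (set fs)"
    and B: "B \<in> carrier_mat (length fs) m" and Q: "Q = mat_of_cols k fs * B"
  shows "distinct (rows B) \<and> module_basis LeftSide m (row_module B) (set (rows B))"
proof -
  have fsc: "set fs \<subseteq> carrier_vec k" using fs by (simp add: module_basis_def)
  have L: "submodule RightSide k L" by (rule module_basis_submodule[OF fs(2)])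
  have rel: "u i = 0"
    if sum0: "vsum m (\<lambda>i. side_scale LeftSide (u i) (row B i)) {..<length fs} = 0\<^sub>v m"
      and i: "i < length fs" for u i
  proof (rule ccontr)
    assume ui: "u i \<noteq> 0"
    obtain y where y: "\<forall>i<length fs. y (fs ! i) = u i"
      by (rule distinct_list_coefficients[OF fs(1)])
    obtain cf where "\<forall>x\<in>L. x = lin_comb RightSide k (cf x) (set fs)"
      and coords: "\<forall>x\<in>L. \<forall>y\<in>L. \<forall>v\<in>set fs. cf (x + y) v = cf x v + cf y v"
        "\<forall>a. \<forall>x\<in>L. \<forall>v\<in>set fs. cf (side_scale RightSide a x) v = side_mult RightSide a (cf x v)"
        "\<forall>v\<in>set fs. \<forall>w\<in>set fs. cf w v = (if v = w then 1 else 0)"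
      by (rule module_basis_coord_functions[OF fs(2) List.finite_set])
    note cf = coords[rule_format]
    define h where "h x = (\<Sum>v\<in>set fs. y v * cf x v)" for x
    have h: "right_functional L h"
      unfolding right_functional_def h_def
      by (auto simp: cf(1,2) side_mult_def distrib_left sum.distrib sum_distrib_right mult.assoc
          simp del: side_scale.simps)
    have h_fs: "h v = y v" if "v \<in> set fs" for v
    proof -
      have "h v = (\<Sum>w\<in>set fs. if w = v then y w else 0)"
        unfolding h_def using that by (intro sum.cong) (auto simp: cf(3))
      then show ?thesis using that by simp
    qed
    define Z where "Z = {x \<in> L. h x = 0}"
    have Z: "submodule RightSide k Z" unfolding Z_def by (rule kernel_submodule[OF L h])
    have "col Q j \<in> Z" if "j < m" for j
    proof -
      obtain c where c: "\<forall>i<length fs. c (fs ! i) = B $$ (i, j)"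
        by (rule distinct_list_coefficients[OF fs(1)])
      have "col Q j = vsum k (\<lambda>i. side_scale RightSide (B $$ (i, j)) (fs ! i)) {..<length fs}"
        unfolding Q by (rule col_mult_conv_vsum[OF fsc B that])
      also have "\<dots> = vsum k (\<lambda>i. side_scale RightSide (c (fs ! i)) (fs ! i)) {..<length fs}"
        using fsc by (intro vsum_cong) (auto simp: c intro: nth_carrier_vec simp del: side_scale.simps)
      also have "\<dots> = lin_comb RightSide k c (set fs)"
        by (rule lin_comb_distinct_list[OF fs(1) fsc, symmetric])
      finally have col: "col Q j = lin_comb RightSide k c (set fs)" .
      have "h (col Q j) = (\<Sum>v\<in>set fs. h v * c v)"
        unfolding col by (rule right_functional_lin_comb[OF L h _ module_basis_subset[OF fs(2)]]) simp
      also have "\<dots> = (\<Sum>i<length fs. h (fs ! i) * c (fs ! i))"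
        using bij_betw_nth[OF fs(1) refl refl] by (rule sum.reindex_bij_betw[symmetric])
      also have "\<dots> = (\<Sum>i<length fs. side_scale LeftSide (u i) (row B i) $ j)"
        using B that by (intro sum.cong) (auto simp: h_fs y c)
      also have "\<dots> = vsum m (\<lambda>i. side_scale LeftSide (u i) (row B i)) {..<length fs} $ j"
        using B that by (intro index_finsum_vec[symmetric]) auto
      also have "\<dots> = 0" using sum0 that by simp
      finally have "h (col Q j) = 0" .
      moreover have "col Q j \<in> L"
        unfolding col by (rule submodule_lin_comb[OF L _ module_basis_subset[OF fs(2)]]) simp
      ultimately show ?thesis by (simp add: Z_def)
    qed
    then have "set (cols Q) \<subseteq> Z" using B Q by (auto simp: cols_def)
    then have QZ: "column_module Q \<subseteq> Z"
      unfolding column_module_def using Q by (intro module_span_minimal) (simp_all add: Z)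
    obtain E where "right_ideal_basis (h ` L) E"
      using right_ideal_free[OF basis image_right_ideal[OF L h]] by blast
    moreover obtain BZ where BZ: "module_basis RightSide k Z BZ"
      using submodule_free[OF basis Z] by blast
    ultimately have "free_factor RightSide k Z L"
      unfolding free_factor_def using kernel_basis_extends[OF L h, of E BZ] by (auto simp: Z_def)
    then have "Z = L" using alg_extension_free_factor_eq[OF alg] QZ by blast
    moreover have "fs ! i \<in> L" using module_basis_subset[OF fs(2)] i by auto
    ultimately have "h (fs ! i) = 0" by (auto simp: Z_def)
    then show False using ui h_fs y i by simp
  qed
  have rows: "set (rows B) \<subseteq> carrier_vec m" "length (rows B) = length fs"
    using B rows_carrier[of B] by auto
  have "u i = 0"
    if sum0: "vsum m (\<lambda>i. side_scale LeftSide (u i) (rows B ! i)) {..<length (rows B)} = 0\<^sub>v m"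
      and i: "i < length (rows B)" for u i
  proof (rule rel)
    have "vsum m (\<lambda>i. side_scale LeftSide (u i) (row B i)) {..<length fs} =
        vsum m (\<lambda>i. side_scale LeftSide (u i) (rows B ! i)) {..<length fs}"
      using B rows by (intro vsum_cong) (auto simp del: side_scale.simps)
    then show "vsum m (\<lambda>i. side_scale LeftSide (u i) (row B i)) {..<length fs} = 0\<^sub>v m"
      using sum0 rows(2) by simp
  qed (use i rows in simp)
  then have "distinct (rows B) \<and>
      module_basis LeftSide m (module_span LeftSide m (set (rows B))) (set (rows B))"
    by (rule module_basis_listI[OF rows(1)])
  then show ?thesis using B by (simp add: row_module_def)
qed

section \<open>Vectors over a field\<close>

lemma vsum_index: "finite I \<Longrightarrow> f \<in> I \<rightarrow> carrier_vec n \<Longrightarrow> i < n \<Longrightarrow> vsum n f I $ i = (\<Sum>x\<in>I. f x $ i)"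
  by (rule index_finsum_vec)

lemma vsum_dim: "f \<in> I \<rightarrow> carrier_vec n \<Longrightarrow> dim_vec (vsum n f I) = n"
  by (rule carrier_vecD[OF vsum_carrier])

lemma additive_vsum:
  fixes f :: "'a::ring_1 Matrix.vec \<Rightarrow> 'b::ring_1 Matrix.vec"
  assumes M: "submodule s n M" and fM: "\<And>x. x \<in> M \<Longrightarrow> f x \<in> carrier_vec N"
    and add: "\<And>x y. x \<in> M \<Longrightarrow> y \<in> M \<Longrightarrow> f (x + y) = f x + f y"
    and I: "finite I" "w \<in> I \<rightarrow> M"
  shows "f (vsum n w I) = vsum N (\<lambda>i. f (w i)) I"
  using I
proof (induction I rule: finite_induct)
  case empty
  have c: "f (0\<^sub>v n) \<in> carrier_vec N" using fM submodule_zero[OF M] by blast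
  have "f (0\<^sub>v n + 0\<^sub>v n) = f (0\<^sub>v n) + f (0\<^sub>v n)" using add submodule_zero[OF M] by blast
  then have eq: "f (0\<^sub>v n) = f (0\<^sub>v n) + f (0\<^sub>v n)" by simp
  have "f (0\<^sub>v n) = 0\<^sub>v N"
  proof (rule eq_vecI)
    fix i assume i: "i < dim_vec (0\<^sub>v N :: 'b Matrix.vec)"
    have "f (0\<^sub>v n) $ i = (f (0\<^sub>v n) + f (0\<^sub>v n)) $ i" using eq by simp
    also have "\<dots> = f (0\<^sub>v n) $ i + f (0\<^sub>v n) $ i" using c i by (intro index_add_vec) auto
    finally show "f (0\<^sub>v n) $ i = 0\<^sub>v N $ i" using i by simp
  qed (use c in simp)
  then show ?case by (simp add: finsum_vec_empty)
next
  case (insert i I)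
  have "vsum n w (insert i I) = w i + vsum n w I"
    using insert submodule_carrier[OF M] by (intro finsum_vec_insert) auto
  moreover have "vsum n w I \<in> M" using insert by (intro submodule_vsum[OF M]) auto
  moreover have "vsum N (\<lambda>i. f (w i)) (insert i I) = f (w i) + vsum N (\<lambda>i. f (w i)) I"
    using insert fM by (intro finsum_vec_insert) auto
  ultimately show ?case using insert add by auto
qed

lemma scalar_prod_vsum:
  fixes x :: "'k::field Matrix.vec"
  assumes "finite I" "f \<in> I \<rightarrow> carrier_vec n" "x \<in> carrier_vec n"
  shows "x \<bullet> vsum n f I = (\<Sum>i\<in>I. x \<bullet> f i)"
  using assms(1,2)
proof (induction I rule: finite_induct)
  case empty
  then show ?case using assms(3) by (simp add: finsum_vec_empty)
next
  case (insert i I)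
  then have "vsum n f (insert i I) = f i + vsum n f I" by (intro finsum_vec_insert) auto
  moreover have "vsum n f I \<in> carrier_vec n" using insert by (intro vsum_carrier) auto
  ultimately show ?case using insert assms(3) by (simp add: scalar_prod_add_distrib[of x n])
qed

lemma vsum_scalar_prod:
  fixes x :: "'k::field Matrix.vec"
  assumes "finite I" "f \<in> I \<rightarrow> carrier_vec n" "x \<in> carrier_vec n"
  shows "vsum n f I \<bullet> x = (\<Sum>i\<in>I. f i \<bullet> x)"
proof -
  have "vsum n f I \<bullet> x = x \<bullet> vsum n f I"
    using comm_scalar_prod[OF vsum_carrier[OF assms(2)] assms(3)] .
  also have "\<dots> = (\<Sum>i\<in>I. x \<bullet> f i)" by (rule scalar_prod_vsum[OF assms])
  also have "\<dots> = (\<Sum>i\<in>I. f i \<bullet> x)"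
    using assms by (intro sum.cong comm_scalar_prod[of _ n]) auto
  finally show ?thesis .
qed

lemma vec_eq_unit_expansion:
  fixes x :: "'k::field Matrix.vec"
  assumes "x \<in> carrier_vec n"
  shows "x = vsum n (\<lambda>i. x $ i \<cdot>\<^sub>v unit_vec n i) {..<n}"
proof (rule eq_vecI)
  have f: "(\<lambda>i. x $ i \<cdot>\<^sub>v unit_vec n i) \<in> {..<n} \<rightarrow> carrier_vec n" by simp
  show "dim_vec x = dim_vec (vsum n (\<lambda>i. x $ i \<cdot>\<^sub>v unit_vec n i) {..<n})"
    using vsum_dim[OF f] assms by simp
  fix j assume "j < dim_vec (vsum n (\<lambda>i. x $ i \<cdot>\<^sub>v unit_vec n i) {..<n})"
  then have j: "j < n" using vsum_dim[OF f] by simp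
  have "vsum n (\<lambda>i. x $ i \<cdot>\<^sub>v unit_vec n i) {..<n} $ j = (\<Sum>i<n. (x $ i \<cdot>\<^sub>v unit_vec n i) $ j)"
    by (rule vsum_index[OF _ f j]) simp
  also have "\<dots> = (\<Sum>i<n. if i = j then x $ i else 0)"
    using j by (intro sum.cong) (auto simp: unit_vec_def)
  also have "\<dots> = x $ j" using j by simp
  finally show "x $ j = vsum n (\<lambda>i. x $ i \<cdot>\<^sub>v unit_vec n i) {..<n} $ j" by simp
qed

lemma carrier_vec_eq_by_pairing:
  fixes v w :: "'k::field Matrix.vec"
  assumes "v \<in> carrier_vec n" "w \<in> carrier_vec n"
    and "\<And>x. x \<in> carrier_vec n \<Longrightarrow> x \<bullet> v = x \<bullet> w"
  shows "v = w"
proof (rule eq_vecI)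
  fix i assume i: "i < dim_vec w"
  then show "v $ i = w $ i"
    using assms(3)[of "unit_vec n i"] assms(1,2) by simp
qed (use assms in simp)

lemma finite_carrier_vec: "finite (carrier_vec n :: 'k::finite Matrix.vec set)"
proof (rule finite_subset)
  show "carrier_vec n \<subseteq> vec n ` ({..<n} \<rightarrow>\<^sub>E (UNIV :: 'k set))"
  proof
    fix v :: "'k Matrix.vec" assume "v \<in> carrier_vec n"
    then have "v = vec n (restrict (($) v) {..<n})" by (intro eq_vecI) simp_all
    then show "v \<in> vec n ` ({..<n} \<rightarrow>\<^sub>E (UNIV :: 'k set))" by (rule image_eqI[where x = "restrict (($) v) {..<n}"]) simp
  qed
qed (simp add: finite_PiE)

section \<open>Module structures and their adjoints\<close>

context
  fixes s :: side and N :: nat and act :: "('f::group_add \<Rightarrow>\<^sub>0 'k::field) \<Rightarrow> 'k Matrix.vec \<Rightarrow> 'k Matrix.vec"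
  assumes act: "act \<in> module_structures s N"
begin

lemma action_PiE: "act a \<in> carrier_vec N \<rightarrow>\<^sub>E carrier_vec N"
  using act unfolding module_structures_def by blast

lemma action_carrier [simp]: "v \<in> carrier_vec N \<Longrightarrow> act a v \<in> carrier_vec N"
  using act unfolding module_structures_def by (blast dest: PiE_mem)

lemma action_add: "v \<in> carrier_vec N \<Longrightarrow> w \<in> carrier_vec N \<Longrightarrow> act a (v + w) = act a v + act a w"
  using act unfolding module_structures_def by blast

lemma action_add_left: "v \<in> carrier_vec N \<Longrightarrow> act (a + b) v = act a v + act b v"
  using act unfolding module_structures_def by blast

lemma action_mult:
  "v \<in> carrier_vec N \<Longrightarrow>
    act (a * b) v = (case s of LeftSide \<Rightarrow> act a (act b v) | RightSide \<Rightarrow> act b (act a v))"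
  using act unfolding module_structures_def by blast

lemma action_side_mult: "v \<in> carrier_vec N \<Longrightarrow> act (side_mult s a b) v = act a (act b v)"
  using action_mult by (cases s) (simp_all add: side_mult_def)

lemma action_one: "v \<in> carrier_vec N \<Longrightarrow> act 1 v = v"
  using act unfolding module_structures_def by blast

lemma action_scalar: "v \<in> carrier_vec N \<Longrightarrow> act (scal c) v = c \<cdot>\<^sub>v v"
  using act unfolding module_structures_def by blast

lemma action_smult:
  assumes v: "v \<in> carrier_vec N"
  shows "act a (c \<cdot>\<^sub>v v) = c \<cdot>\<^sub>v act a v"
proof -
  have "act a (act (scal c) v) = act (side_mult s a (scal c)) v" using v by (simp add: action_side_mult)
  also have "side_mult s a (scal c) = side_mult s (scal c) a"
    by (cases s) (simp_all add: side_mult_def scal_central)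
  also have "act (side_mult s (scal c) a) v = act (scal c) (act a v)" using v by (simp add: action_side_mult)
  finally show ?thesis using v by (simp add: action_scalar)
qed

lemma action_zero_left: "v \<in> carrier_vec N \<Longrightarrow> act 0 v = 0\<^sub>v N"
  using action_scalar[of v 0] by (auto intro!: eq_vecI)

lemma action_zero [simp]: "act a (0\<^sub>v N) = 0\<^sub>v N"
proof -
  have zero: "0 \<cdot>\<^sub>v v = 0\<^sub>v N" if "v \<in> carrier_vec N" for v :: "'k Matrix.vec"
    using that by (intro eq_vecI) auto
  show ?thesis using action_smult[of "0\<^sub>v N" a 0] by (simp add: zero)
qed

lemma action_vsum:
  assumes "finite I" "w \<in> I \<rightarrow> carrier_vec N"
  shows "act a (vsum N w I) = vsum N (\<lambda>i. act a (w i)) I"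
proof (rule additive_vsum[of LeftSide])
  show "submodule LeftSide N (carrier_vec N :: 'k Matrix.vec set)"
    by (auto simp: submodule_def simp del: side_scale.simps)
qed (use assms in \<open>auto intro: action_add\<close>)

end

fun opposite :: "side \<Rightarrow> side" where
  "opposite LeftSide = RightSide"
| "opposite RightSide = LeftSide"

text \<open>
  The action by transposed matrices, that is, the adjoint with respect to the standard bilinear form on \<open>K^N\<close>.
\<close>
definition adjoint_action ::
    "nat \<Rightarrow> ('a \<Rightarrow> 'k::field Matrix.vec \<Rightarrow> 'k Matrix.vec) \<Rightarrow> 'a \<Rightarrow> 'k Matrix.vec \<Rightarrow> 'k Matrix.vec" where
  "adjoint_action N act a = (\<lambda>v\<in>carrier_vec N. vec N (\<lambda>i. act a (unit_vec N i) \<bullet> v))"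

lemma adjoint_action_carrier: "v \<in> carrier_vec N \<Longrightarrow> adjoint_action N act a v \<in> carrier_vec N"
  by (simp add: adjoint_action_def)

lemma adjoint_action_pairing:
  assumes act: "act \<in> module_structures s N" and x: "x \<in> carrier_vec N" and v: "v \<in> carrier_vec N"
  shows "x \<bullet> adjoint_action N act a v = act a x \<bullet> v"
proof -
  have "act a x = act a (vsum N (\<lambda>i. x $ i \<cdot>\<^sub>v unit_vec N i) {..<N})"
    using vec_eq_unit_expansion[OF x] by simp
  also have "\<dots> = vsum N (\<lambda>i. act a (x $ i \<cdot>\<^sub>v unit_vec N i)) {..<N}"
    by (rule action_vsum[OF act]) auto
  also have "\<dots> \<bullet> v = (\<Sum>i<N. act a (x $ i \<cdot>\<^sub>v unit_vec N i) \<bullet> v)"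
    using v by (intro vsum_scalar_prod) (auto intro: action_carrier[OF act])
  also have "\<dots> = (\<Sum>i<N. x $ i * (act a (unit_vec N i) \<bullet> v))"
    using v action_carrier[OF act, of "unit_vec N _" a]
    by (intro sum.cong) (auto simp: action_smult[OF act] smult_scalar_prod_distrib[of _ N])
  also have "\<dots> = x \<bullet> adjoint_action N act a v"
    using x v by (simp add: adjoint_action_def scalar_prod_def atLeast0LessThan)
  finally show ?thesis by simp
qed

text \<open>
  Taking adjoints reverses products, which exchanges left and right module structures.
\<close>
lemma adjoint_action_structure:
  assumes act: "act \<in> module_structures s N"
  shows "adjoint_action N act \<in> module_structures (opposite s) N"
proof -
  note pair = adjoint_action_pairing[OF act]
  note carr = adjoint_action_carrier[of _ N act]
  note acarr = action_carrier[OF act]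
  have add: "adjoint_action N act a (v + w) = adjoint_action N act a v + adjoint_action N act a w"
    if "v \<in> carrier_vec N" "w \<in> carrier_vec N" for a v w
    using that
    by (intro carrier_vec_eq_by_pairing[of _ N])
       (simp_all add: carr pair acarr scalar_prod_add_distrib[of _ N])
  have addl: "adjoint_action N act (a + b) v = adjoint_action N act a v + adjoint_action N act b v"
    if "v \<in> carrier_vec N" for a b v
    using that
    by (intro carrier_vec_eq_by_pairing[of _ N])
       (simp_all add: carr pair acarr scalar_prod_add_distrib[of _ N] add_scalar_prod_distrib[of _ N]
          action_add_left[OF act])
  have mult: "adjoint_action N act (a * b) v = (case opposite s of
      LeftSide \<Rightarrow> adjoint_action N act a (adjoint_action N act b v)
    | RightSide \<Rightarrow> adjoint_action N act b (adjoint_action N act a v))"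
    if "v \<in> carrier_vec N" for a b v
    using that
    by (intro carrier_vec_eq_by_pairing[of _ N]; cases s)
       (simp_all add: carr pair acarr action_mult[OF act])
  have one: "adjoint_action N act 1 v = v" if "v \<in> carrier_vec N" for v
    using that
    by (intro carrier_vec_eq_by_pairing[of _ N]) (simp_all add: carr pair action_one[OF act])
  have scalar: "adjoint_action N act (scal c) v = c \<cdot>\<^sub>v v" if "v \<in> carrier_vec N" for c v
    using that
    by (intro carrier_vec_eq_by_pairing[of _ N]) (simp_all add: carr pair action_scalar[OF act])
  have PiE: "adjoint_action N act a \<in> carrier_vec N \<rightarrow>\<^sub>E carrier_vec N" for a
    unfolding adjoint_action_def by (auto intro!: PiE_I)
  show ?thesis
    unfolding module_structures_def
    using PiE add addl mult one scalar by blast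
qed

lemma adjoint_action_involutive:
  assumes act: "act \<in> module_structures s N"
  shows "adjoint_action N (adjoint_action N act) = act"
proof (intro ext)
  fix a v
  show "adjoint_action N (adjoint_action N act) a v = act a v"
  proof (cases "v \<in> carrier_vec N")
    case True
    note act' = adjoint_action_structure[OF act]
    show ?thesis
    proof (rule carrier_vec_eq_by_pairing[of _ N])
      fix x :: "'b Matrix.vec" assume x: "x \<in> carrier_vec N"
      have "x \<bullet> adjoint_action N (adjoint_action N act) a v = adjoint_action N act a x \<bullet> v"
        by (rule adjoint_action_pairing[OF act' x True])
      also have "\<dots> = v \<bullet> adjoint_action N act a x"
        using True x by (intro comm_scalar_prod[of _ N] adjoint_action_carrier)
      also have "\<dots> = act a v \<bullet> x" by (rule adjoint_action_pairing[OF act True x])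
      also have "\<dots> = x \<bullet> act a v"
        using True x by (intro comm_scalar_prod[of _ N] action_carrier[OF act])
      finally show "x \<bullet> adjoint_action N (adjoint_action N act) a v = x \<bullet> act a v" .
    qed (use True adjoint_action_carrier action_carrier[OF act] in auto)
  next
    case False
    have "act a \<in> carrier_vec N \<rightarrow>\<^sub>E carrier_vec N"
      using act unfolding module_structures_def by blast
    then show ?thesis using False PiE_arb[of "act a"] by (simp add: adjoint_action_def)
  qed
qed

lemma opposite_opposite [simp]: "opposite (opposite s) = s"
  by (cases s) auto

lemma adjoint_action_bij:
  "bij_betw (adjoint_action N) (module_structures s N) (module_structures (opposite s) N)"
proof (rule bij_betw_byWitness[where f' = "adjoint_action N"])
  show "adjoint_action N ` module_structures s N \<subseteq> module_structures (opposite s) N"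
    using adjoint_action_structure by blast
  show "adjoint_action N ` module_structures (opposite s) N \<subseteq> module_structures s N"
    using adjoint_action_structure[of _ "opposite s" N] by auto
qed (use adjoint_action_involutive in auto)

text \<open>
  The group can act trivially.  The algebra then acts through the augmentation \<open>\<epsilon>\<close>, which is obtained from
  the linear map \<open>D\<close> that sends every group element to \<open>1\<close>.
\<close>
lemma module_structures_nonempty: "module_structures s N \<noteq> {}"
proof -
  obtain D :: "('a \<Rightarrow>\<^sub>0 'b) \<Rightarrow> 'a \<Rightarrow>\<^sub>0 'b" where D_add: "\<And>p q. D (p + q) = D p + D q"
    and D_scale: "\<And>c p. D (scal c * p) = scal c * D p" and D_mon: "\<And>g. D (mon g) = 1"
    using linear_extension_of_group_map[of "\<lambda>_. 1"] by blast
  define \<epsilon> where "\<epsilon> p = Poly_Mapping.lookup (D p) 0" for p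
  have D_mono: "D (scal c * mon g) = scal c" for c g
    using D_scale[of c "mon g"] D_mon[of g] by simp
  have D_eps: "D p = scal (\<epsilon> p)" for p
  proof (induction p rule: group_algebra_induct)
    case (monomial g c)
    then show ?case unfolding \<epsilon>_def D_mono by simp
  next
    case (add p q)
    have "\<epsilon> (p + q) = \<epsilon> p + \<epsilon> q" by (simp add: \<epsilon>_def D_add lookup_add)
    then show ?case using add by (simp add: D_add single_add)
  qed
  have D_mult: "D (p * q) = D p * D q" for p q
  proof (induction p rule: group_algebra_induct)
    case (monomial g c)
    show ?case
    proof (induction q rule: group_algebra_induct)
      case (monomial h d)
      have "scal c * mon g * (scal d * mon h) = scal (c * d) * (mon (g + h) :: 'a \<Rightarrow>\<^sub>0 'b)"
        by (simp add: mult_single)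
      then show ?case by (simp only: D_mono) (simp add: mult_single)
    next
      case (add p q)
      then show ?case by (simp add: distrib_left D_add)
    qed
  next
    case (add p q)
    then show ?case by (simp add: distrib_right D_add)
  qed
  have eps: "\<epsilon> (p + q) = \<epsilon> p + \<epsilon> q" "\<epsilon> (p * q) = \<epsilon> p * \<epsilon> q" "\<epsilon> 1 = 1" "\<epsilon> (scal c) = c" for p q c
  proof -
    show "\<epsilon> (p + q) = \<epsilon> p + \<epsilon> q" by (simp add: \<epsilon>_def D_add lookup_add)
    have "scal (\<epsilon> (p * q)) = (scal (\<epsilon> p * \<epsilon> q) :: 'a \<Rightarrow>\<^sub>0 'b)"
      using D_mult[of p q] by (simp add: D_eps mult_single)
    then show "\<epsilon> (p * q) = \<epsilon> p * \<epsilon> q" by (metis lookup_single_eq)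
    show "\<epsilon> 1 = 1" using D_mon[of 0] by (simp add: \<epsilon>_def)
    show "\<epsilon> (scal c) = c" using D_mono[of c 0] by (simp add: \<epsilon>_def)
  qed
  define act where "act a = (\<lambda>v\<in>carrier_vec N. \<epsilon> a \<cdot>\<^sub>v v)" for a
  have act: "act a v = \<epsilon> a \<cdot>\<^sub>v v" if "v \<in> carrier_vec N" for a v
    using that by (simp add: act_def)
  have "act \<in> module_structures s N"
    unfolding module_structures_def mem_Collect_eq
  proof (intro conjI allI ballI)
    show "act a \<in> carrier_vec N \<rightarrow>\<^sub>E carrier_vec N" for a
      unfolding act_def by simp
  next
    fix a b and v :: "'b Matrix.vec" assume v: "v \<in> carrier_vec N"
    then show "act (a * b) v = (case s of LeftSide \<Rightarrow> act a (act b v) | RightSide \<Rightarrow> act b (act a v))"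
      by (cases s) (simp_all add: act eps smult_smult_assoc mult.commute)
  qed (simp_all add: act eps smult_add_distrib_vec[of _ N] add_smult_distrib_vec)
  then show ?thesis by blast
qed

text \<open>
  A structure is determined by the finitely many linear maps by which the generators act.
\<close>
lemma module_structures_finite:
  fixes S :: "'f::group_add set"
  assumes basis: "free_group_basis S" and S: "finite S"
  shows "finite (module_structures s N :: (('f \<Rightarrow>\<^sub>0 'k::{field,finite}) \<Rightarrow> _) set)"
proof (rule inj_on_finite)
  let ?C = "carrier_vec N :: 'k Matrix.vec set"
  show "finite (S \<rightarrow>\<^sub>E (?C \<rightarrow>\<^sub>E ?C))"
    using S by (simp add: finite_PiE finite_carrier_vec)
  show "(\<lambda>act. \<lambda>s\<in>S. act (mon s)) ` module_structures s N \<subseteq> S \<rightarrow>\<^sub>E (?C \<rightarrow>\<^sub>E ?C)"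
  proof (rule image_subsetI)
    fix act :: "('f \<Rightarrow>\<^sub>0 'k) \<Rightarrow> 'k Matrix.vec \<Rightarrow> 'k Matrix.vec"
    assume "act \<in> module_structures s N"
    then show "(\<lambda>s\<in>S. act (mon s)) \<in> S \<rightarrow>\<^sub>E (?C \<rightarrow>\<^sub>E ?C)"
      by (simp add: restrict_PiE_iff action_PiE)
  qed
  show "inj_on (\<lambda>act. \<lambda>s\<in>S. act (mon s)) (module_structures s N :: (('f \<Rightarrow>\<^sub>0 'k) \<Rightarrow> _) set)"
  proof (rule inj_onI)
    fix act act' :: "('f \<Rightarrow>\<^sub>0 'k) \<Rightarrow> 'k Matrix.vec \<Rightarrow> 'k Matrix.vec"
    assume act: "act \<in> module_structures s N" and act': "act' \<in> module_structures s N"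
      and "(\<lambda>s\<in>S. act (mon s)) = (\<lambda>s\<in>S. act' (mon s))"
    then have S_eq: "act (mon t) = act' (mon t)" if "t \<in> S" for t
      using that by (metis restrict_apply')
    note c = action_carrier[OF act] action_carrier[OF act']
    define P where "P a \<longleftrightarrow> (\<forall>v\<in>?C. act a v = act' a v)" for a
    have mult: "P (a * b)" if "P a" "P b" for a b
      using that c by (cases s) (simp_all add: P_def action_mult[OF act] action_mult[OF act'])
    have inverse: "P (mon (- t))" if "t \<in> S" for t
      unfolding P_def
    proof
      fix v assume v: "v \<in> ?C"
      have one: "side_mult s (mon t) (mon (- t)) = (1 :: 'f \<Rightarrow>\<^sub>0 'k)"
        "side_mult s (mon (- t)) (mon t) = (1 :: 'f \<Rightarrow>\<^sub>0 'k)"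
        by (cases s; simp add: side_mult_def)+
      have "act (mon t) (act (mon (- t)) v) = v"
        using v action_side_mult[OF act, of v "mon t" "mon (- t)"] by (simp only: one action_one[OF act])
      then have "act' (mon (- t)) (act' (mon t) (act (mon (- t)) v)) = act' (mon (- t)) v"
        using S_eq[OF that] by simp
      moreover have "act' (mon (- t)) (act' (mon t) (act (mon (- t)) v)) = act (mon (- t)) v"
        using v c action_side_mult[OF act', of "act (mon (- t)) v" "mon (- t)" "mon t"]
        by (simp only: one action_one[OF act'])
      ultimately show "act (mon (- t)) v = act' (mon (- t)) v" by simp
    qed
    have P_mon: "P (mon g)" for g
      using basis
    proof (induction g rule: free_group_induct)
      case zero
      then show ?case by (simp add: P_def action_one[OF act] action_one[OF act'])
    next
      case (plus g t)
      then show ?case using mult[of "mon g" "mon t"] S_eq by (simp add: P_def)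
    next
      case (minus g t)
      then show ?case using mult[of "mon g" "mon (- t)"] inverse by simp
    qed
    have P: "P a" for a
    proof (induction a rule: group_algebra_induct)
      case (monomial g x)
      have "P (scal x)" by (simp add: P_def action_scalar[OF act] action_scalar[OF act'])
      then show ?case using P_mon by (intro mult)
    next
      case (add p q)
      then show ?case by (simp add: P_def action_add_left[OF act] action_add_left[OF act'])
    qed
    show "act = act'"
    proof
      fix a
      have "act a \<in> ?C \<rightarrow>\<^sub>E ?C" "act' a \<in> ?C \<rightarrow>\<^sub>E ?C"
        using action_PiE[OF act] action_PiE[OF act'] by blast+
      then show "act a = act' a" using P[of a] unfolding P_def by (intro PiE_ext) auto
    qed
  qed
qed

section \<open>Homomorphisms into a module structure\<close>

context
  fixes s :: side and n N :: nat and M :: "('f::group_add \<Rightarrow>\<^sub>0 'k::field) Matrix.vec set"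
    and act :: "('f \<Rightarrow>\<^sub>0 'k) \<Rightarrow> 'k Matrix.vec \<Rightarrow> 'k Matrix.vec"
  assumes act: "act \<in> module_structures s N" and M: "submodule s n M"
begin

lemma hom_PiE: "\<phi> \<in> module_homs s N act M \<Longrightarrow> \<phi> \<in> M \<rightarrow>\<^sub>E carrier_vec N"
  by (simp add: module_homs_def)

lemma hom_carrier: "\<phi> \<in> module_homs s N act M \<Longrightarrow> x \<in> M \<Longrightarrow> \<phi> x \<in> carrier_vec N"
  using hom_PiE by (rule PiE_mem)

lemma hom_add: "\<phi> \<in> module_homs s N act M \<Longrightarrow> x \<in> M \<Longrightarrow> y \<in> M \<Longrightarrow> \<phi> (x + y) = \<phi> x + \<phi> y"
  by (simp add: module_homs_def)

lemma hom_scale: "\<phi> \<in> module_homs s N act M \<Longrightarrow> x \<in> M \<Longrightarrow> \<phi> (side_scale s a x) = act a (\<phi> x)"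
  by (simp add: module_homs_def)

lemma hom_vsum:
  assumes \<phi>: "\<phi> \<in> module_homs s N act M" and I: "finite I" "w \<in> I \<rightarrow> M"
  shows "\<phi> (vsum n (\<lambda>i. side_scale s (p i) (w i)) I) = vsum N (\<lambda>i. act (p i) (\<phi> (w i))) I"
proof -
  have w: "w i \<in> M" if "i \<in> I" for i using I(2) that by blast
  have "\<phi> (vsum n (\<lambda>i. side_scale s (p i) (w i)) I) = vsum N (\<lambda>i. \<phi> (side_scale s (p i) (w i))) I"
    by (rule additive_vsum[OF M hom_carrier[OF \<phi>] hom_add[OF \<phi>] I(1)])
       (use w submodule_scale[OF M] in auto)
  also have "\<dots> = vsum N (\<lambda>i. act (p i) (\<phi> (w i))) I"
    using w by (intro vsum_cong) (auto simp: hom_scale[OF \<phi>] intro!: action_carrier[OF act] hom_carrier[OF \<phi>])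
  finally show ?thesis .
qed

lemma homs_agree_submodule:
  assumes "\<phi> \<in> module_homs s N act M" "\<psi> \<in> module_homs s N act M"
  shows "submodule s n {x \<in> M. \<phi> x = \<psi> x}"
proof -
  have "\<phi> (0\<^sub>v n) = \<psi> (0\<^sub>v n)"
    using hom_vsum[OF assms(1), of "{} :: nat set"] hom_vsum[OF assms(2), of "{} :: nat set"]
    by (simp add: finsum_vec_empty)
  then show ?thesis
    using M hom_add[OF assms(1)] hom_add[OF assms(2)] hom_scale[OF assms(1)] hom_scale[OF assms(2)]
    unfolding submodule_def by auto
qed

lemma hom_combination:
  assumes "\<phi> \<in> module_homs s N act M" "\<psi> \<in> module_homs s N act M"
  shows "(\<lambda>x\<in>M. \<phi> x + c \<cdot>\<^sub>v \<psi> x) \<in> module_homs s N act M"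
proof -
  note hc = hom_carrier[OF assms(1)] hom_carrier[OF assms(2)]
  have "\<phi> (x + y) + c \<cdot>\<^sub>v \<psi> (x + y) = (\<phi> x + c \<cdot>\<^sub>v \<psi> x) + (\<phi> y + c \<cdot>\<^sub>v \<psi> y)"
    if "x \<in> M" "y \<in> M" for x y
  proof -
    note d = carrier_vecD[OF hc(1)[OF that(1)]] carrier_vecD[OF hc(2)[OF that(1)]]
      carrier_vecD[OF hc(1)[OF that(2)]] carrier_vecD[OF hc(2)[OF that(2)]]
    show ?thesis
      using that by (intro eq_vecI) (simp_all add: hom_add[OF assms(1)] hom_add[OF assms(2)] d distrib_left)
  qed
  moreover have "\<phi> (side_scale s a x) + c \<cdot>\<^sub>v \<psi> (side_scale s a x) = act a (\<phi> x + c \<cdot>\<^sub>v \<psi> x)"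
    if "x \<in> M" for a x
    using that hc by (simp add: hom_scale[OF assms(1)] hom_scale[OF assms(2)] action_add[OF act] action_smult[OF act])
  ultimately show ?thesis
    unfolding module_homs_def using M hc by (auto simp: submodule_add[OF M] submodule_scale[OF M])
qed

lemma zero_hom: "(\<lambda>x\<in>M. 0\<^sub>v N) \<in> module_homs s N act M"
  unfolding module_homs_def
  by (auto simp: submodule_add[OF M] submodule_scale[OF M] action_zero[OF act])

lemma hom_vanishes_iff:
  assumes \<phi>: "\<phi> \<in> module_homs s N act M" and X: "X \<subseteq> M"
  shows "module_span s n X \<subseteq> {x \<in> M. \<phi> x = 0\<^sub>v N} \<longleftrightarrow> (\<forall>x\<in>X. \<phi> x = 0\<^sub>v N)"
proof
  assume "module_span s n X \<subseteq> {x \<in> M. \<phi> x = 0\<^sub>v N}"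
  then show "\<forall>x\<in>X. \<phi> x = 0\<^sub>v N"
    using module_span_superset[of X n s] X submodule_carrier[OF M] by blast
next
  assume zero: "\<forall>x\<in>X. \<phi> x = 0\<^sub>v N"
  have "{x \<in> M. \<phi> x = (\<lambda>x\<in>M. 0\<^sub>v N) x} = {x \<in> M. \<phi> x = 0\<^sub>v N}" by auto
  then have "submodule s n {x \<in> M. \<phi> x = 0\<^sub>v N}"
    using homs_agree_submodule[OF \<phi> zero_hom] by simp
  then show "module_span s n X \<subseteq> {x \<in> M. \<phi> x = 0\<^sub>v N}"
    by (rule module_span_minimal) (use zero X in blast)
qed

text \<open>
  The universal property of a free module, with target the space \<open>K^N\<close> equipped with the given action.
\<close>
lemma hom_with_basis_values:
  assumes B: "module_basis s n M B" "finite B" and y: "y \<in> B \<rightarrow> carrier_vec N"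
  obtains \<phi> where "\<phi> \<in> module_homs s N act M" "\<forall>v\<in>B. \<phi> v = y v"
proof -
  obtain cf where "\<forall>x\<in>M. x = lin_comb s n (cf x) B"
    and coords: "\<forall>x\<in>M. \<forall>y\<in>M. \<forall>v\<in>B. cf (x + y) v = cf x v + cf y v"
      "\<forall>a. \<forall>x\<in>M. \<forall>v\<in>B. cf (side_scale s a x) v = side_mult s a (cf x v)"
      "\<forall>v\<in>B. \<forall>w\<in>B. cf w v = (if v = w then 1 else 0)"
    by (rule module_basis_coord_functions[OF B])
  note cf = coords[rule_format]
  note yc = funcset_mem[OF y]
  have f: "(\<lambda>v. act (p v) (y v)) \<in> B \<rightarrow> carrier_vec N" for p
    using yc action_carrier[OF act] by blast
  define \<phi> where "\<phi> = (\<lambda>x\<in>M. vsum N (\<lambda>v. act (cf x v) (y v)) B)"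
  have \<phi>: "\<phi> x = vsum N (\<lambda>v. act (cf x v) (y v)) B" if "x \<in> M" for x
    using that by (simp add: \<phi>_def)
  have add: "\<phi> (x + x') = \<phi> x + \<phi> x'" if "x \<in> M" "x' \<in> M" for x x'
  proof (rule eq_vecI)
    note xx = submodule_add[OF M that]
    show "dim_vec (\<phi> (x + x')) = dim_vec (\<phi> x + \<phi> x')"
      using that xx by (simp add: \<phi> vsum_dim[OF f])
    fix i assume "i < dim_vec (\<phi> x + \<phi> x')"
    then have i: "i < N" using that by (simp add: \<phi> vsum_dim[OF f])
    have "\<phi> (x + x') $ i = (\<Sum>v\<in>B. act (cf (x + x') v) (y v) $ i)"
      using xx by (simp add: \<phi> vsum_index[OF B(2) f i])
    also have "\<dots> = (\<Sum>v\<in>B. act (cf x v) (y v) $ i + act (cf x' v) (y v) $ i)"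
      using that yc i carrier_vecD[OF action_carrier[OF act yc]]
      by (intro sum.cong) (simp_all add: cf(1) action_add_left[OF act])
    also have "\<dots> = \<phi> x $ i + \<phi> x' $ i"
      using that by (simp add: \<phi> vsum_index[OF B(2) f i] sum.distrib)
    also have "\<dots> = (\<phi> x + \<phi> x') $ i"
      using that i by (simp add: \<phi> vsum_dim[OF f])
    finally show "\<phi> (x + x') $ i = (\<phi> x + \<phi> x') $ i" .
  qed
  have scale: "\<phi> (side_scale s a x) = act a (\<phi> x)" if "x \<in> M" for a x
  proof -
    have "\<phi> (side_scale s a x) = vsum N (\<lambda>v. act (cf (side_scale s a x) v) (y v)) B"
      using submodule_scale[OF M that] by (rule \<phi>)
    also have "\<dots> = vsum N (\<lambda>v. act a (act (cf x v) (y v))) B"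
      using that yc
      by (intro vsum_cong) (auto simp: cf(2) action_side_mult[OF act] intro!: action_carrier[OF act])
    also have "\<dots> = act a (vsum N (\<lambda>v. act (cf x v) (y v)) B)"
      by (rule action_vsum[OF act B(2) f, symmetric])
    finally show ?thesis using that by (simp add: \<phi>)
  qed
  have hom: "\<phi> \<in> module_homs s N act M"
    unfolding module_homs_def mem_Collect_eq
  proof (intro conjI ballI allI)
    show "\<phi> \<in> M \<rightarrow>\<^sub>E carrier_vec N"
      unfolding \<phi>_def restrict_PiE_iff using vsum_carrier[OF f] by blast
  qed (simp_all add: add scale)
  have "\<phi> w = y w" if "w \<in> B" for w
  proof (rule eq_vecI)
    have wM: "w \<in> M" using module_basis_subset[OF B(1)] that by blast
    show "dim_vec (\<phi> w) = dim_vec (y w)"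
      using wM yc[OF that] by (simp add: \<phi> vsum_dim[OF f])
    fix i assume "i < dim_vec (y w)"
    then have i: "i < N" using yc[OF that] by simp
    have "\<phi> w $ i = (\<Sum>v\<in>B. act (cf w v) (y v) $ i)"
      using wM by (simp add: \<phi> vsum_index[OF B(2) f i])
    also have "\<dots> = (\<Sum>v\<in>B. if v = w then y v $ i else 0)"
      using that yc i by (intro sum.cong) (auto simp: cf(3) action_one[OF act] action_zero_left[OF act])
    also have "\<dots> = y w $ i" using that B(2) by simp
    finally show "\<phi> w $ i = y w $ i" .
  qed
  then show ?thesis using hom that by blast
qed

end

lemma finite_homs:
  fixes M :: "('f::group_add \<Rightarrow>\<^sub>0 'k::{field,finite}) Matrix.vec set"
  assumes act: "act \<in> module_structures s N" and B: "module_basis s n M B" "finite B"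
  shows "finite (module_homs s N act M)"
proof (rule inj_on_finite)
  have M: "submodule s n M" by (rule module_basis_submodule[OF B(1)])
  have BM: "B \<subseteq> M" by (rule module_basis_subset[OF B(1)])
  let ?C = "carrier_vec N :: 'k Matrix.vec set"
  show "finite (B \<rightarrow>\<^sub>E ?C)"
    using B(2) by (simp add: finite_PiE finite_carrier_vec)
  show "(\<lambda>\<phi>. restrict \<phi> B) ` module_homs s N act M \<subseteq> B \<rightarrow>\<^sub>E ?C"
  proof (rule image_subsetI)
    fix \<phi> assume "\<phi> \<in> module_homs s N act M"
    then show "restrict \<phi> B \<in> B \<rightarrow>\<^sub>E ?C"
      using hom_carrier[OF act M] BM unfolding restrict_PiE_iff by blast
  qed
  show "inj_on (\<lambda>\<phi>. restrict \<phi> B) (module_homs s N act M)"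
  proof (rule inj_onI)
    fix \<phi> \<psi> assume \<phi>: "\<phi> \<in> module_homs s N act M" and \<psi>: "\<psi> \<in> module_homs s N act M"
      and eq: "restrict \<phi> B = restrict \<psi> B"
    have "B \<subseteq> {x \<in> M. \<phi> x = \<psi> x}"
    proof
      fix x assume "x \<in> B"
      then show "x \<in> {x \<in> M. \<phi> x = \<psi> x}"
        using fun_cong[OF eq, of x] BM by auto
    qed
    then have "module_span s n B \<subseteq> {x \<in> M. \<phi> x = \<psi> x}"
      by (rule module_span_minimal[OF homs_agree_submodule[OF act M \<phi> \<psi>]])
    then have "\<phi> x = \<psi> x" if "x \<in> M" for x
      using B(1) that by (auto simp: module_basis_def)
    then show "\<phi> = \<psi>"
      using PiE_ext[OF hom_PiE[OF act M \<phi>] hom_PiE[OF act M \<psi>]] by blast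
  qed
qed

section \<open>Counting zeros of a pairing\<close>

text \<open>
  The translations \<open>T a\<close> identify all fibres of \<open>f\<close> with the fibre over \<open>0\<close>.
\<close>
lemma fiber_card:
  fixes f :: "'z \<Rightarrow> 'k::{field,finite}"
  assumes T: "\<And>a z. z \<in> Z \<Longrightarrow> T a z \<in> Z" "\<And>a z. z \<in> Z \<Longrightarrow> f (T a z) = f z + a"
    "\<And>a z. z \<in> Z \<Longrightarrow> T (- a) (T a z) = z"
  shows "CARD('k) * card {z \<in> Z. f z = 0} = card Z"
proof -
  have inv: "T a (T (- a) z) = z" if "z \<in> Z" for a z
    using T(3)[OF that, of "- a"] by simp
  have "bij_betw (\<lambda>(a, z). T a z) (UNIV \<times> {z \<in> Z. f z = 0}) Z"
    by (rule bij_betw_byWitness[where f' = "\<lambda>z. (f z, T (- f z) z)"]) (auto simp: T inv)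
  then show ?thesis
    using bij_betw_same_card by (fastforce simp: card_cartesian_product)
qed

text \<open>
  Count the pairs with \<open>\<beta> y z = 0\<close> by rows: each \<open>y\<close> in the left kernel contributes \<open>card Z\<close>, every other
  \<open>y\<close> contributes \<open>card Z / q\<close>.  The equation is multiplied by \<open>q\<close> and arranged so that no
  subtraction of natural numbers occurs.
\<close>
lemma pairing_zero_count:
  fixes \<beta> :: "'y \<Rightarrow> 'z \<Rightarrow> 'k::{field,finite}"
  assumes Y: "finite Y" and Z: "finite Z"
    and fiber: "\<And>y. y \<in> Y \<Longrightarrow> \<exists>z\<in>Z. \<beta> y z \<noteq> 0 \<Longrightarrow> CARD('k) * card {z \<in> Z. \<beta> y z = 0} = card Z"
  shows "CARD('k) * card {(y, z) \<in> Y \<times> Z. \<beta> y z = 0} + card {y \<in> Y. \<forall>z\<in>Z. \<beta> y z = 0} * card Z =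
    CARD('k) * (card {y \<in> Y. \<forall>z\<in>Z. \<beta> y z = 0} * card Z) + card Y * card Z"
proof -
  let ?q = "CARD('k)" and ?Y0 = "{y \<in> Y. \<forall>z\<in>Z. \<beta> y z = 0}"
  have "{(y, z) \<in> Y \<times> Z. \<beta> y z = 0} = Sigma Y (\<lambda>y. {z \<in> Z. \<beta> y z = 0})" by auto
  then have "?q * card {(y, z) \<in> Y \<times> Z. \<beta> y z = 0} = (\<Sum>y\<in>Y. ?q * card {z \<in> Z. \<beta> y z = 0})"
    using Y Z by (simp add: card_SigmaI sum_distrib_left)
  also have "\<dots> = (\<Sum>y\<in>Y - ?Y0. ?q * card {z \<in> Z. \<beta> y z = 0}) + (\<Sum>y\<in>?Y0. ?q * card {z \<in> Z. \<beta> y z = 0})"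
    using Y by (intro sum.subset_diff) auto
  also have "(\<Sum>y\<in>Y - ?Y0. ?q * card {z \<in> Z. \<beta> y z = 0}) = (\<Sum>y\<in>Y - ?Y0. card Z)"
    by (rule sum.cong) (auto intro!: fiber)
  also have "(\<Sum>y\<in>?Y0. ?q * card {z \<in> Z. \<beta> y z = 0}) = (\<Sum>y\<in>?Y0. ?q * card Z)"
  proof (rule sum.cong[OF refl])
    fix y assume "y \<in> ?Y0"
    then have "{z \<in> Z. \<beta> y z = 0} = Z" by blast
    then show "?q * card {z \<in> Z. \<beta> y z = 0} = ?q * card Z" by simp
  qed
  finally have eq: "?q * card {(y, z) \<in> Y \<times> Z. \<beta> y z = 0} =
      card (Y - ?Y0) * card Z + card ?Y0 * (?q * card Z)" by simp
  have "card (Y - ?Y0) + card ?Y0 = card Y"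
    using Y card_mono[of Y ?Y0] by (subst card_Diff_subset) auto
  then have "card Y * card Z = card (Y - ?Y0) * card Z + card ?Y0 * card Z"
    by (simp flip: add_mult_distrib)
  then show ?thesis unfolding eq by simp
qed

text \<open>
  Row rank equals column rank, in the form: the two kernels of a pairing have the same density.  The number of
  zeros of the pairing can be computed by rows or by columns, and it determines either density.
\<close>
lemma pairing_kernels_card:
  fixes \<beta> :: "'y \<Rightarrow> 'z \<Rightarrow> 'k::{field,finite}"
  assumes Y: "finite Y" and Z: "finite Z"
    and fiberZ: "\<And>y. y \<in> Y \<Longrightarrow> \<exists>z\<in>Z. \<beta> y z \<noteq> 0 \<Longrightarrow> CARD('k) * card {z \<in> Z. \<beta> y z = 0} = card Z"
    and fiberY: "\<And>z. z \<in> Z \<Longrightarrow> \<exists>y\<in>Y. \<beta> y z \<noteq> 0 \<Longrightarrow> CARD('k) * card {y \<in> Y. \<beta> y z = 0} = card Y"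
  shows "card {y \<in> Y. \<forall>z\<in>Z. \<beta> y z = 0} * card Z = card {z \<in> Z. \<forall>y\<in>Y. \<beta> y z = 0} * card Y"
proof -
  let ?q = "CARD('k)"
  define u where "u = card {y \<in> Y. \<forall>z\<in>Z. \<beta> y z = 0} * card Z"
  define v where "v = card {z \<in> Z. \<forall>y\<in>Y. \<beta> y z = 0} * card Y"
  define p where "p = card {(y, z) \<in> Y \<times> Z. \<beta> y z = 0}"
  have "card {(z, y) \<in> Z \<times> Y. \<beta> y z = 0} = p"
    unfolding p_def by (rule bij_betw_same_card[of prod.swap]) (auto intro!: bij_betwI[of _ _ _ prod.swap])
  then have "?q * p + u = ?q * u + card Y * card Z" "?q * p + v = ?q * v + card Y * card Z"
    using pairing_zero_count[OF Y Z fiberZ] pairing_zero_count[OF Z Y fiberY, of "\<lambda>z. z"]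
    by (simp_all add: u_def v_def p_def mult.commute)
  \<comment> \<open>Both equations have the form \<open>(q - 1) * x = const\<close>, and \<open>q - 1\<close> is positive.\<close>
  moreover have "2 \<le> ?q"
    using card_mono[of "UNIV :: 'k set" "{0, 1}"] by simp
  then obtain r where "?q = r + 2" by (metis add.commute le_Suc_ex)
  ultimately have "(r + 1) * u = (r + 1) * v" by (simp add: algebra_simps)
  then have "u = v \<or> r + 1 = 0" by (simp only: mult_cancel1)
  then show ?thesis by (simp add: u_def v_def)
qed

section \<open>Duality of homomorphisms and the theorem\<close>

text \<open>
  Homomorphisms form a vector space over \<open>K\<close> and evaluation against fixed vectors is linear on it, so a
  nonzero evaluation takes all values equally often.
\<close>
lemma homs_fiber_card:
  fixes M :: "('f::group_add \<Rightarrow>\<^sub>0 'k::{field,finite}) Matrix.vec set"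
  assumes act: "act \<in> module_structures s N" and M: "submodule s n M"
    and w: "w \<in> J \<rightarrow> M" and z: "z \<in> J \<rightarrow> carrier_vec N"
    and nonzero: "\<exists>\<phi>\<in>module_homs s N act M. (\<Sum>j\<in>J. \<phi> (w j) \<bullet> z j) \<noteq> 0"
  shows "CARD('k) * card {\<phi> \<in> module_homs s N act M. (\<Sum>j\<in>J. \<phi> (w j) \<bullet> z j) = 0} =
    card (module_homs s N act M)"
proof -
  let ?H = "module_homs s N act M"
  define f where "f \<phi> = (\<Sum>j\<in>J. \<phi> (w j) \<bullet> z j)" for \<phi> :: "('f \<Rightarrow>\<^sub>0 'k) Matrix.vec \<Rightarrow> 'k Matrix.vec"
  obtain \<psi> where \<psi>: "\<psi> \<in> ?H" "f \<psi> \<noteq> 0" using nonzero by (auto simp: f_def)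
  define T where "T a \<phi> = (\<lambda>x\<in>M. \<phi> x + (a / f \<psi>) \<cdot>\<^sub>v \<psi> x)" for a \<phi>
  note wM = funcset_mem[OF w] and zc = funcset_mem[OF z]
  note \<psi>c = hom_carrier[OF act M \<psi>(1)]
  have "CARD('k) * card {\<phi> \<in> ?H. f \<phi> = 0} = card ?H"
  proof (rule fiber_card[where T = T])
    fix a \<phi> assume \<phi>: "\<phi> \<in> ?H"
    note \<phi>c = hom_carrier[OF act M \<phi>]
    show "T a \<phi> \<in> ?H" unfolding T_def by (rule hom_combination[OF act M \<phi> \<psi>(1)])
    have "f (T a \<phi>) = (\<Sum>j\<in>J. T a \<phi> (w j) \<bullet> z j)" by (rule f_def)
    also have "\<dots> = (\<Sum>j\<in>J. \<phi> (w j) \<bullet> z j + (a / f \<psi>) * (\<psi> (w j) \<bullet> z j))"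
      unfolding T_def using wM zc \<phi>c \<psi>c
      by (intro sum.cong) (simp_all add: add_scalar_prod_distrib[of _ N] smult_scalar_prod_distrib[of _ N])
    also have "\<dots> = f \<phi> + (a / f \<psi>) * f \<psi>"
      by (simp add: f_def sum.distrib sum_distrib_left)
    finally show "f (T a \<phi>) = f \<phi> + a" using \<psi>(2) by simp
    show "T (- a) (T a \<phi>) = \<phi>"
    proof
      fix x
      show "T (- a) (T a \<phi>) x = \<phi> x"
      proof (cases "x \<in> M")
        case True
        note d = carrier_vecD[OF \<phi>c[OF True]] carrier_vecD[OF \<psi>c[OF True]]
        show ?thesis using True by (intro eq_vecI) (simp_all add: T_def d)
      next
        case False
        then show ?thesis using PiE_arb[OF hom_PiE[OF act M \<phi>]] by (simp add: T_def)
      qed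
    qed
  qed
  then show ?thesis by (simp add: f_def)
qed

text \<open>
  By freeness a homomorphism can take any value on one basis element and vanish on the others.
\<close>
lemma homs_pairing_nondegenerate:
  fixes M :: "('f::group_add \<Rightarrow>\<^sub>0 'k::field) Matrix.vec set"
  assumes act: "act \<in> module_structures s N"
    and ws: "distinct ws" "module_basis s n M (set ws)"
    and z: "\<And>j. j < length ws \<Longrightarrow> z j \<in> carrier_vec N"
    and zero: "\<forall>\<phi>\<in>module_homs s N act M. (\<Sum>j<length ws. \<phi> (ws ! j) \<bullet> z j) = 0"
    and i: "i < length ws"
  shows "z i = 0\<^sub>v N"
proof (rule carrier_vec_eq_by_pairing[of _ N])
  have M: "submodule s n M" by (rule module_basis_submodule[OF ws(2)])
  fix x :: "'k Matrix.vec" assume x: "x \<in> carrier_vec N"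
  obtain \<phi> where \<phi>: "\<phi> \<in> module_homs s N act M"
    and val: "\<forall>v\<in>set ws. \<phi> v = (if v = ws ! i then x else 0\<^sub>v N)"
    using hom_with_basis_values[OF act M ws(2) List.finite_set, of "\<lambda>v. if v = ws ! i then x else 0\<^sub>v N"] x
    by auto
  have "(\<Sum>j<length ws. \<phi> (ws ! j) \<bullet> z j) = (\<Sum>j<length ws. if j = i then x \<bullet> z j else 0)"
    using val z ws(1) i by (intro sum.cong) (auto simp: nth_eq_iff_index_eq)
  also have "\<dots> = x \<bullet> z i" using i by simp
  finally show "x \<bullet> z i = x \<bullet> 0\<^sub>v N" using zero \<phi> x by simp
qed (use z i in auto)

text \<open>
  Let \<open>f\<^sub>j\<close> be the basis of \<open>L\<close>, \<open>g\<^sub>i\<close> the basis of \<open>M\<close>, and \<open>b\<^sub>j\<close>, \<open>c\<^sub>i\<close> the rows of \<open>B\<close> and \<open>P * B\<close>.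
  The pairing \<open>\<beta>\<close> between homomorphisms \<open>\<phi>\<close> on \<open>M\<close> and \<open>\<psi>\<close> on the row module of \<open>B\<close> has two descriptions,
  \[ \sum_j \phi(f_j) \bullet \psi(b_j) = \sum_i \phi(g_i) \bullet \psi(c_i), \]
  because \<open>f\<^sub>j\<close> is the sum of the \<open>g\<^sub>i P\<^sub>i\<^sub>j\<close>, \<open>c\<^sub>i\<close> is the sum of the \<open>P\<^sub>i\<^sub>j b\<^sub>j\<close>, and the actions on the two sides
  are adjoint.  As the \<open>\<psi>(b\<^sub>j)\<close> are arbitrary, the first description shows that \<open>\<phi>\<close> is in the left kernel exactly if
  it kills \<open>L\<close>.  As the \<open>\<phi>(g\<^sub>i)\<close> are arbitrary, the second one shows that \<open>\<psi>\<close> is in the right kernel exactly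
  if it kills the row module of \<open>P * B\<close>.  So the claim is that both kernels have the same density.
\<close>
theorem hom_kernels_duality:
  fixes L M :: "('f::group_add \<Rightarrow>\<^sub>0 'k::{field,finite}) Matrix.vec set"
  assumes act: "act \<in> module_structures RightSide N"
    and fs: "distinct fs" "module_basis RightSide k L (set fs)"
    and gs: "distinct gs" "module_basis RightSide k M (set gs)"
    and P: "P \<in> carrier_mat (length gs) (length fs)" "mat_of_cols k fs = mat_of_cols k gs * P"
    and B: "B \<in> carrier_mat (length fs) m" "distinct (rows B)"
      "module_basis LeftSide m (row_module B) (set (rows B))"
  defines "Y \<equiv> module_homs RightSide N act M"
    and "Z \<equiv> module_homs LeftSide N (adjoint_action N act) (row_module B)"
  shows "card {\<phi> \<in> Y. L \<subseteq> {x \<in> M. \<phi> x = 0\<^sub>v N}} * card Z =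
    card {\<psi> \<in> Z. row_module (P * B) \<subseteq> {x \<in> row_module B. \<psi> x = 0\<^sub>v N}} * card Y"
proof -
  let ?l = "length fs" and ?t = "length gs"
  have act': "adjoint_action N act \<in> module_structures LeftSide N"
    using adjoint_action_structure[OF act] by simp
  have M: "submodule RightSide k M" by (rule module_basis_submodule[OF gs(2)])
  have D: "submodule LeftSide m (row_module B)" by (rule module_basis_submodule[OF B(3)])
  have gsc: "set gs \<subseteq> carrier_vec k" using gs by (simp add: module_basis_def)
  have fsc: "set fs \<subseteq> carrier_vec k" using fs by (simp add: module_basis_def)
  have gM: "gs ! i \<in> M" if "i < ?t" for i using module_basis_subset[OF gs(2)] that by auto
  have len: "length (rows B) = ?l" "\<And>j. j < ?l \<Longrightarrow> rows B ! j = row B j" using B(1) by auto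
  have rD: "row B j \<in> row_module B" if "j < ?l" for j
    using module_basis_subset[OF B(3)] that len by (metis nth_mem subsetD)
  have f_eq: "fs ! j = vsum k (\<lambda>i. side_scale RightSide (P $$ (i, j)) (gs ! i)) {..<?t}" if "j < ?l" for j
  proof -
    have "fs ! j = col (mat_of_cols k fs) j"
      using that nth_carrier_vec[OF fsc] by simp
    then show ?thesis using col_mult_conv_vsum[OF gsc P(1) that] P(2) by simp
  qed
  have fM: "fs ! j \<in> M" if "j < ?l" for j
    unfolding f_eq[OF that]
    by (intro submodule_vsum[OF M]) (auto intro!: submodule_scale[OF M] gM simp del: side_scale.simps)
  have cD: "row (P * B) i \<in> row_module B" if "i < ?t" for i
    unfolding row_mult_conv_vsum[OF P(1) B(1) that]
    by (intro submodule_vsum[OF D]) (auto intro!: submodule_scale[OF D] rD simp del: side_scale.simps)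
  note Yc = hom_carrier[OF act M, folded Y_def] and Zc = hom_carrier[OF act' D, folded Z_def]
  define \<beta> where "\<beta> \<phi> \<psi> = (\<Sum>j<?l. \<phi> (fs ! j) \<bullet> \<psi> (row B j))"
    for \<phi> \<psi> :: "('f \<Rightarrow>\<^sub>0 'k) Matrix.vec \<Rightarrow> 'k Matrix.vec"
  have \<beta>_rows: "\<beta> \<phi> \<psi> = (\<Sum>j<?l. \<psi> (row B j) \<bullet> \<phi> (fs ! j))" if "\<phi> \<in> Y" "\<psi> \<in> Z" for \<phi> \<psi>
    unfolding \<beta>_def using that fM rD
    by (intro sum.cong comm_scalar_prod[of _ N]) (auto intro: Yc Zc)
  have \<beta>_adjoint: "\<beta> \<phi> \<psi> = (\<Sum>i<?t. \<phi> (gs ! i) \<bullet> \<psi> (row (P * B) i))" if \<phi>: "\<phi> \<in> Y" and \<psi>: "\<psi> \<in> Z" for \<phi> \<psi>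
  proof -
    have pair: "\<phi> (fs ! j) \<bullet> \<psi> (row B j) =
        (\<Sum>i<?t. act (P $$ (i, j)) (\<phi> (gs ! i)) \<bullet> \<psi> (row B j))" if "j < ?l" for j
    proof -
      have "\<phi> (fs ! j) = vsum N (\<lambda>i. act (P $$ (i, j)) (\<phi> (gs ! i))) {..<?t}"
        unfolding f_eq[OF that]
        by (rule hom_vsum[OF act M]) (use \<phi> gM in \<open>auto simp: Y_def\<close>)
      then show ?thesis
        using that \<psi> \<phi>
        by (simp only:) (intro vsum_scalar_prod[of _ _ N], auto intro!: action_carrier[OF act] Yc[OF \<phi>] Zc[OF \<psi>] gM rD)
    qed
    have adj: "\<phi> (gs ! i) \<bullet> \<psi> (row (P * B) i) =
        (\<Sum>j<?l. act (P $$ (i, j)) (\<phi> (gs ! i)) \<bullet> \<psi> (row B j))" if "i < ?t" for i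
    proof -
      have "\<psi> (row (P * B) i) = vsum N (\<lambda>j. adjoint_action N act (P $$ (i, j)) (\<psi> (row B j))) {..<?l}"
        unfolding row_mult_conv_vsum[OF P(1) B(1) that]
        by (rule hom_vsum[OF act' D]) (use \<psi> rD in \<open>auto simp: Z_def\<close>)
      also have "\<phi> (gs ! i) \<bullet> \<dots> =
          (\<Sum>j<?l. \<phi> (gs ! i) \<bullet> adjoint_action N act (P $$ (i, j)) (\<psi> (row B j)))"
        using that \<phi> \<psi> by (intro scalar_prod_vsum[of _ _ N]) (auto intro!: adjoint_action_carrier Yc[OF \<phi>] Zc[OF \<psi>] gM rD)
      also have "\<dots> = (\<Sum>j<?l. act (P $$ (i, j)) (\<phi> (gs ! i)) \<bullet> \<psi> (row B j))"
        using that \<phi> \<psi>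
        by (intro sum.cong refl adjoint_action_pairing[OF act]) (auto intro!: Yc[OF \<phi>] Zc[OF \<psi>] gM rD)
      finally show ?thesis .
    qed
    have "\<beta> \<phi> \<psi> = (\<Sum>j<?l. \<Sum>i<?t. act (P $$ (i, j)) (\<phi> (gs ! i)) \<bullet> \<psi> (row B j))"
      unfolding \<beta>_def by (intro sum.cong) (simp_all add: pair)
    also have "\<dots> = (\<Sum>i<?t. \<Sum>j<?l. act (P $$ (i, j)) (\<phi> (gs ! i)) \<bullet> \<psi> (row B j))"
      by (rule sum.swap)
    also have "\<dots> = (\<Sum>i<?t. \<phi> (gs ! i) \<bullet> \<psi> (row (P * B) i))"
      by (intro sum.cong) (simp_all add: adj)
    finally show ?thesis .
  qed
  have kerY: "L \<subseteq> {x \<in> M. \<phi> x = 0\<^sub>v N} \<longleftrightarrow> (\<forall>\<psi>\<in>Z. \<beta> \<phi> \<psi> = 0)" if \<phi>: "\<phi> \<in> Y" for \<phi>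
  proof -
    have fsM: "set fs \<subseteq> M" using fM by (auto simp: in_set_conv_nth)
    have "L \<subseteq> {x \<in> M. \<phi> x = 0\<^sub>v N} \<longleftrightarrow> (\<forall>v\<in>set fs. \<phi> v = 0\<^sub>v N)"
      using hom_vanishes_iff[OF act M _ fsM, of \<phi>] \<phi> fs(2) by (simp add: Y_def module_basis_def)
    also have "\<dots> \<longleftrightarrow> (\<forall>j<?l. \<phi> (fs ! j) = 0\<^sub>v N)" by (rule all_set_conv_all_nth)
    also have "\<dots> \<longleftrightarrow> (\<forall>\<psi>\<in>Z. \<beta> \<phi> \<psi> = 0)"
    proof
      assume "\<forall>j<?l. \<phi> (fs ! j) = 0\<^sub>v N"
      then show "\<forall>\<psi>\<in>Z. \<beta> \<phi> \<psi> = 0" using rD Zc by (auto simp: \<beta>_def)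
    next
      assume zero: "\<forall>\<psi>\<in>Z. \<beta> \<phi> \<psi> = 0"
      show "\<forall>j<?l. \<phi> (fs ! j) = 0\<^sub>v N"
      proof (intro allI impI)
        fix j assume "j < ?l"
        show "\<phi> (fs ! j) = 0\<^sub>v N"
        proof (rule homs_pairing_nondegenerate[OF act' B(2,3), of "\<lambda>j. \<phi> (fs ! j)"])
          show "\<forall>\<psi>\<in>module_homs LeftSide N (adjoint_action N act) (row_module B).
              (\<Sum>j<length (rows B). \<psi> (rows B ! j) \<bullet> \<phi> (fs ! j)) = 0"
            using zero \<beta>_rows[OF \<phi>] len by (simp add: Z_def)
        qed (use \<open>j < ?l\<close> len Yc[OF \<phi>] fM in auto)
      qed
    qed
    finally show ?thesis .
  qed
  have kerZ: "row_module (P * B) \<subseteq> {x \<in> row_module B. \<psi> x = 0\<^sub>v N} \<longleftrightarrow> (\<forall>\<phi>\<in>Y. \<beta> \<phi> \<psi> = 0)"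
    if \<psi>: "\<psi> \<in> Z" for \<psi>
  proof -
    have rows: "set (rows (P * B)) = (\<lambda>i. row (P * B) i) ` {..<?t}"
      using P(1) by (auto simp: rows_def)
    then have sub: "set (rows (P * B)) \<subseteq> row_module B" using cD by auto
    have "row_module (P * B) \<subseteq> {x \<in> row_module B. \<psi> x = 0\<^sub>v N} \<longleftrightarrow> (\<forall>v\<in>set (rows (P * B)). \<psi> v = 0\<^sub>v N)"
      using hom_vanishes_iff[OF act' D _ sub, of \<psi>] \<psi> B(1) by (simp add: Z_def row_module_def[of "P * B"])
    also have "\<dots> \<longleftrightarrow> (\<forall>i<?t. \<psi> (row (P * B) i) = 0\<^sub>v N)" unfolding rows by blast
    also have "\<dots> \<longleftrightarrow> (\<forall>\<phi>\<in>Y. \<beta> \<phi> \<psi> = 0)"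
    proof
      assume "\<forall>i<?t. \<psi> (row (P * B) i) = 0\<^sub>v N"
      then show "\<forall>\<phi>\<in>Y. \<beta> \<phi> \<psi> = 0" using gM Yc \<beta>_adjoint[OF _ \<psi>] by auto
    next
      assume zero: "\<forall>\<phi>\<in>Y. \<beta> \<phi> \<psi> = 0"
      show "\<forall>i<?t. \<psi> (row (P * B) i) = 0\<^sub>v N"
      proof (intro allI impI)
        fix i assume "i < ?t"
        show "\<psi> (row (P * B) i) = 0\<^sub>v N"
        proof (rule homs_pairing_nondegenerate[OF act gs, of "\<lambda>i. \<psi> (row (P * B) i)"])
          show "\<forall>\<phi>\<in>module_homs RightSide N act M.
              (\<Sum>i<?t. \<phi> (gs ! i) \<bullet> \<psi> (row (P * B) i)) = 0"
            using zero \<beta>_adjoint[OF _ \<psi>] by (simp add: Y_def)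
        qed (use \<open>i < ?t\<close> Zc[OF \<psi>] cD in auto)
      qed
    qed
    finally show ?thesis .
  qed
  have "card {\<phi> \<in> Y. \<forall>\<psi>\<in>Z. \<beta> \<phi> \<psi> = 0} * card Z = card {\<psi> \<in> Z. \<forall>\<phi>\<in>Y. \<beta> \<phi> \<psi> = 0} * card Y"
  proof (rule pairing_kernels_card)
    show "finite Y" unfolding Y_def by (rule finite_homs[OF act gs(2)]) simp
    show "finite Z" unfolding Z_def by (rule finite_homs[OF act' B(3)]) simp
  next
    fix \<phi> assume \<phi>: "\<phi> \<in> Y" and "\<exists>\<psi>\<in>Z. \<beta> \<phi> \<psi> \<noteq> 0"
    then have "\<exists>\<psi>\<in>Z. (\<Sum>j<?l. \<psi> (row B j) \<bullet> \<phi> (fs ! j)) \<noteq> 0"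
      using \<beta>_rows[OF \<phi>] by auto
    then have "CARD('k) * card {\<psi> \<in> Z. (\<Sum>j<?l. \<psi> (row B j) \<bullet> \<phi> (fs ! j)) = 0} = card Z"
      unfolding Z_def by (intro homs_fiber_card[OF act' D]) (use rD fM Yc[OF \<phi>] in auto)
    moreover have "{\<psi> \<in> Z. \<beta> \<phi> \<psi> = 0} = {\<psi> \<in> Z. (\<Sum>j<?l. \<psi> (row B j) \<bullet> \<phi> (fs ! j)) = 0}"
      using \<beta>_rows[OF \<phi>] by auto
    ultimately show "CARD('k) * card {\<psi> \<in> Z. \<beta> \<phi> \<psi> = 0} = card Z" by simp
  next
    fix \<psi> assume \<psi>: "\<psi> \<in> Z" and "\<exists>\<phi>\<in>Y. \<beta> \<phi> \<psi> \<noteq> 0"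
    then show "CARD('k) * card {\<phi> \<in> Y. \<beta> \<phi> \<psi> = 0} = card Y"
      unfolding Y_def \<beta>_def by (intro homs_fiber_card[OF act M]) (use rD fM Zc[OF \<psi>] in auto)
  qed
  moreover have "{\<phi> \<in> Y. L \<subseteq> {x \<in> M. \<phi> x = 0\<^sub>v N}} = {\<phi> \<in> Y. \<forall>\<psi>\<in>Z. \<beta> \<phi> \<psi> = 0}"
    using kerY by blast
  moreover have "{\<psi> \<in> Z. row_module (P * B) \<subseteq> {x \<in> row_module B. \<psi> x = 0\<^sub>v N}} =
      {\<psi> \<in> Z. \<forall>\<phi>\<in>Y. \<beta> \<phi> \<psi> = 0}"
    using kerZ by blast
  ultimately show ?thesis by (simp only:)
qed

lemma phi_eq_average:
  fixes S :: "'f::group_add set" and M :: "('f \<Rightarrow>\<^sub>0 'k::{field,finite}) Matrix.vec set"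
  assumes S: "free_group_basis S" "finite S" and B: "module_basis s n M B" "finite B"
  shows "phi s L M N = real CARD('k) ^ N *
    ((\<Sum>act\<in>module_structures s N.
        real (card {\<phi> \<in> module_homs s N act M. L \<subseteq> {x \<in> M. \<phi> x = 0\<^sub>v N}}) /
        real (card (module_homs s N act M))) / real (card (module_structures s N :: (('f \<Rightarrow>\<^sub>0 'k) \<Rightarrow> _) set)))"
proof -
  let ?S = "module_structures s N :: (('f \<Rightarrow>\<^sub>0 'k) \<Rightarrow> 'k Matrix.vec \<Rightarrow> 'k Matrix.vec) set"
  let ?K = "{\<phi>. L \<subseteq> {x \<in> M. \<phi> x = 0\<^sub>v N}}"
  have M: "submodule s n M" by (rule module_basis_submodule[OF B(1)])
  have fin: "finite ?S" by (rule module_structures_finite[OF S])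
  have "measure_pmf.prob (random_hom s N M) ?K =
      (\<integral>act. measure_pmf.prob (pmf_of_set (module_homs s N act M)) ?K \<partial>measure_pmf (pmf_of_set ?S))"
    unfolding random_hom_def measure_pmf_bind
    by (rule measure_pmf.measure_bind[where N = "count_space UNIV"])
       (use measurable_measure_pmf[of "\<lambda>act. pmf_of_set (module_homs s N act M)"] in simp_all)
  also have "\<dots> = (\<Sum>act\<in>?S. measure_pmf.prob (pmf_of_set (module_homs s N act M)) ?K) / card ?S"
    by (rule integral_pmf_of_set[OF module_structures_nonempty fin])
  also have "(\<Sum>act\<in>?S. measure_pmf.prob (pmf_of_set (module_homs s N act M)) ?K) =
      (\<Sum>act\<in>?S. real (card {\<phi> \<in> module_homs s N act M. L \<subseteq> {x \<in> M. \<phi> x = 0\<^sub>v N}}) /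
        real (card (module_homs s N act M)))"
  proof (rule sum.cong[OF refl])
    fix act assume act: "act \<in> ?S"
    have "module_homs s N act M \<noteq> {}" using zero_hom[OF act M] by blast
    moreover have "module_homs s N act M \<inter> ?K = {\<phi> \<in> module_homs s N act M. L \<subseteq> {x \<in> M. \<phi> x = 0\<^sub>v N}}"
      by blast
    ultimately show "measure_pmf.prob (pmf_of_set (module_homs s N act M)) ?K =
        real (card {\<phi> \<in> module_homs s N act M. L \<subseteq> {x \<in> M. \<phi> x = 0\<^sub>v N}}) /
        real (card (module_homs s N act M))"
      using measure_pmf_of_set[OF _ finite_homs[OF act B], of ?K] by simp
  qed
  finally show ?thesis by (simp add: phi_def)
qed

theorem theorem1p7:
  fixes S :: "'f::group_add set"
    and Q :: "('f \<Rightarrow>\<^sub>0 'k::{field,finite}) mat"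
    and k m :: nat
    and L M :: "('f \<Rightarrow>\<^sub>0 'k) Matrix.vec set"
  assumes "finite S"
    and "free_group_basis S"
    and "Q \<in> carrier_mat k m"
    and "alg_extension RightSide k (column_module Q) L"
    and "alg_extension RightSide k (column_module Q) M"
    and "L \<subseteq> M"
  shows "\<forall>N\<ge>1. phi RightSide L M N = phi LeftSide (Q_dual Q M) (Q_dual Q L) N"
proof (intro allI impI)
  fix N :: nat
  obtain fs B where fs: "distinct fs" "module_basis RightSide k L (set fs)"
    and B: "B \<in> carrier_mat (length fs) m" "Q = mat_of_cols k fs * B"
    and dualL: "Q_dual Q L = row_module B"
    by (rule alg_extension_dual[OF assms(3,4)])
  obtain gs C where gs: "distinct gs" "module_basis RightSide k M (set gs)"
    and C: "C \<in> carrier_mat (length gs) m" "Q = mat_of_cols k gs * C"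
    and dualM: "Q_dual Q M = row_module C"
    by (rule alg_extension_dual[OF assms(3,5)])
  have fsM: "set fs \<subseteq> M" using module_basis_subset[OF fs(2)] assms(6) by blast
  have "mat_of_cols k fs * B = mat_of_cols k gs * C" using B(2) C(2) by simp
  then obtain P where P: "P \<in> carrier_mat (length gs) (length fs)"
      "mat_of_cols k fs = mat_of_cols k gs * P" and CP: "C = P * B"
    by (rule change_of_basis[OF gs fsM B(1) C(1)])
  have rows: "distinct (rows B)" "module_basis LeftSide m (row_module B) (set (rows B))"
    using dual_rows_independent[OF assms(2,4) fs B] by blast+
  define r where "r s act X Y = real (card {\<phi> \<in> module_homs s N act Y. X \<subseteq> {x \<in> Y. \<phi> x = 0\<^sub>v N}}) /
    real (card (module_homs s N act Y))"
    for s act and X Y :: "('f \<Rightarrow>\<^sub>0 'k) Matrix.vec set"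
  have ratio: "r RightSide act L M = r LeftSide (adjoint_action N act) (row_module C) (row_module B)"
    if act: "act \<in> module_structures RightSide N" for act
  proof -
    have act': "adjoint_action N act \<in> module_structures LeftSide N"
      using adjoint_action_structure[OF act] by simp
    have "finite (module_homs RightSide N act M)"
      by (rule finite_homs[OF act gs(2)]) simp
    then have "card (module_homs RightSide N act M) \<noteq> 0"
      using zero_hom[OF act module_basis_submodule[OF gs(2)]] by auto
    moreover have "finite (module_homs LeftSide N (adjoint_action N act) (row_module B))"
      by (rule finite_homs[OF act' rows(2)]) simp
    then have "card (module_homs LeftSide N (adjoint_action N act) (row_module B)) \<noteq> 0"
      using zero_hom[OF act' module_basis_submodule[OF rows(2)]] by auto
    ultimately show ?thesis
      using hom_kernels_duality[OF act fs gs P B(1) rows]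
      unfolding r_def CP by (simp add: frac_eq_eq flip: of_nat_mult)
  qed
  let ?R = "module_structures RightSide N :: (('f \<Rightarrow>\<^sub>0 'k) \<Rightarrow> 'k Matrix.vec \<Rightarrow> 'k Matrix.vec) set"
  let ?L = "module_structures LeftSide N :: (('f \<Rightarrow>\<^sub>0 'k) \<Rightarrow> 'k Matrix.vec \<Rightarrow> 'k Matrix.vec) set"
  have bij: "bij_betw (adjoint_action N) ?R ?L"
    using adjoint_action_bij[of N RightSide] by simp
  have "(\<Sum>act\<in>?R. r RightSide act L M) =
      (\<Sum>act\<in>?R. r LeftSide (adjoint_action N act) (row_module C) (row_module B))"
    by (rule sum.cong[OF refl ratio])
  also have "\<dots> = (\<Sum>act\<in>?L. r LeftSide act (row_module C) (row_module B))"
    by (rule sum.reindex_bij_betw[OF bij])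
  finally show "phi RightSide L M N = phi LeftSide (Q_dual Q M) (Q_dual Q L) N"
    unfolding dualL dualM phi_eq_average[OF assms(2,1) gs(2) List.finite_set]
      phi_eq_average[OF assms(2,1) rows(2) List.finite_set]
    using bij_betw_same_card[OF bij] by (simp add: r_def)
qed

end
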